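(* Let $n\ge1$ (and, if $\operatorname{char}(K)=p>0$, assume $n\le p$) and let $f\in C(R,K)$. The following are equivalent: (1) $f$ is an $n$-th Lipschitz function; (2) $f\in C^{n-1}(R,K)$, and writing its expansion $f=\sum_{r\in\mathcal{R}}\sum_{j=0}^{n-1}b_r^{n-1,j}(f)\gamma_r^{\,n-1-j}(x-r)^j\chi_r$, one has $\sup_{r\in\mathcal{R}_+,\,0\le j\le n-1}|b_r^{n-1,j}(f)\gamma_r^{-1}|<\infty$. Moreover, if these conditions hold then $A_f=\sup_{r\in\mathcal{R}_+,\,0\le j\le n-1}|b_r^{n-1,j}(f)\gamma_r^{-1}|$.
   Context: $K$ is a local field: the fraction field of a complete discrete valuation ring $R$ with finite residue field $\kappa$ of cardinality $q$. Fix a uniformizer $\pi$, $|\pi|=q^{-1}$, and a set $\mathcal{T}\subset R$ of representatives of $\kappa$ containing $0$; every $x\in R$ has a unique expansion $\sum_{i\ge0}a_i\pi^i$, $a_i\in\mathcal{T}$. Let $\mathcal{R}_0=\{0\}$, $\mathcal{R}_m=\{\sum_{i=0}^{m-1}a_i\pi^i: a_i\in\mathcal{T}\}$ ($m\ge1$), $\mathcal{R}=\bigcup_m\mathcal{R}_m$, $\mathcal{R}_+=\bigcup_{m\ge1}\mathcal{R}_m$; $l(r)$ is the $m$ with $r\in\mathcal{R}_m\setminus\mathcal{R}_{m-1}$. For $r\in\mathcal{R}_+$ written $r=\sum_{i=0}^{m}a_i\pi^i$, $a_m\neq0$, put $r_-=\sum_{i=0}^{m-1}a_i\pi^i$; $\gamma_0=1$,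 $\gamma_r=r-r_-$. $\chi_r$ is the characteristic function of $\{x:|x-r|\le q^{-l(r)}\}$. Difference quotients: $\nabla^kR=\{(x_1,\dots,x_k)\in R^k$ pairwise distinct$\}$; $\Phi_0f=f$, $\Phi_kf(x_1,\dots,x_{k+1})=\frac{\Phi_{k-1}f(x_1,x_3,\dots,x_{k+1})-\Phi_{k-1}f(x_2,x_3,\dots,x_{k+1})}{x_1-x_2}$ on $\nabla^{k+1}R$. $f$ is $C^k$ if $\Phi_kf$ extends continuously to $R^{k+1}$; $C^k(R,K)$ the set of such ($C^0$ = continuous). An $n$-th Lipschitz function is $f\in C(R,K)$ with $A_f:=\sup\{|\Phi_nf(x)|: x\in\nabla^{n+1}R\}<\infty$; $A_f$ is its Lipschitz constant. Expansion: for $m\ge0$ (with $m\le p-1$ if $\operatorname{char}K=p>0$), every $f\in C^m(R,K)$ has a unique representation $f=\sum_{r\in\mathcal{R}}\sum_{j=0}^m b_r^{m,j}(f)\gamma_r^{\,m-j}(x-r)^j\chi_r$ with coefficients tending to $0$, the family $\{\gamma_r^{m-j}(x-r)^j\chi_r\}$ being an orthonormal basis of $C^m(R,K)$ for the paper's norm.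
   Formalization: The set R_+ is taken to be R without 0; read literally, the union of the R_m with m ≥ 1 contains 0, and then the final equality fails for f = 1, n = 1, where A_f = 0 but b_0 = 1 and γ_0 = 1. *)

theory Defs
  imports "HOL-Analysis.Analysis" "HOL-Computational_Algebra.Computational_Algebra"
begin

section \<open>Local fields\<close>

class nonarch_field = field + complete_space +
  fixes vabs :: "'a \<Rightarrow> real"
  assumes dist_eq_vabs: "dist x y = vabs (x - y)"
    and vabs_times: "vabs (x * y) = vabs x * vabs y"
    and vabs_plus_le_max: "vabs (x + y) \<le> max (vabs x) (vabs y)"

context nonarch_field
begin

definition val_ring :: "'a set" where
  "val_ring = {x. vabs x \<le> 1}"

definition max_ideal :: "'a set" where
  "max_ideal = {x. vabs x < 1}"

definition residue_field :: "'a set set" where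
  "residue_field = val_ring // {(x, y). x \<in> val_ring \<and> y \<in> val_ring \<and> x - y \<in> max_ideal}"

definition residue_card :: "'a itself \<Rightarrow> nat" where
  "residue_card _ = card (residue_field :: 'a set set)"

definition uniformizer :: "'a \<Rightarrow> bool" where
  "uniformizer \<pi> \<longleftrightarrow> max_ideal = (\<lambda>y. \<pi> * y) ` val_ring"

end

text \<open>
  The valuation ring of a local field is a discrete valuation ring: its maximal ideal is generated
  by one element, which is nonzero by the normalisation \<open>vabs \<pi> = 1 / q\<close>, with \<open>q\<close> the
  cardinality of the residue field. The class \<open>real_normed_field\<close> is not usable here, as it
  requires an algebra over the reals.
\<close>

class local_field = nonarch_field +
  assumes finite_residue_field: "finite (residue_field :: 'a set set)"
    and ex_uniformizer: "\<exists>\<pi> :: 'a. uniformizer \<pi> \<and> vabs \<pi> = 1 / real (residue_card TYPE('a))"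

definition residue_reps :: "'a::local_field set \<Rightarrow> bool" where
  "residue_reps T \<longleftrightarrow>
     T \<subseteq> val_ring \<and> 0 \<in> T \<and> (\<forall>x\<in>val_ring. \<exists>!t. t \<in> T \<and> x - t \<in> max_ideal)"

section \<open>Difference quotients\<close>

text \<open>
  A \<open>k\<close>-tuple of elements of the valuation ring is a function in \<open>PiE {..<k} (\<lambda>_. val_ring)\<close>,
  so the coordinates \<open>x\<^sub>1, \<dots>, x\<^sub>k\<close> are numbered from \<open>0\<close>. The product topology on
  \<open>nat \<Rightarrow> 'a\<close> induces the product topology on this set of tuples.
\<close>

definition tuples :: "nat \<Rightarrow> (nat \<Rightarrow> 'a::local_field) set" where
  "tuples k = PiE {..<k} (\<lambda>_. val_ring)"

definition distinct_tuples :: "nat \<Rightarrow> (nat \<Rightarrow> 'a::local_field) set" where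
  "distinct_tuples k = {x \<in> tuples k. inj_on x {..<k}}"

primrec diff_quot :: "nat \<Rightarrow> ('a::local_field \<Rightarrow> 'a) \<Rightarrow> (nat \<Rightarrow> 'a) \<Rightarrow> 'a" where
  "diff_quot 0 f x = f (x 0)"
| "diff_quot (Suc k) f x =
     (diff_quot k f (\<lambda>i. if i = 0 then x 0 else x (Suc i)) - diff_quot k f (\<lambda>i. x (Suc i)))
       / (x 0 - x 1)"

text \<open>Functions on the valuation ring are total functions of which only the values on
  \<open>val_ring\<close> matter.\<close>

definition C_k :: "nat \<Rightarrow> ('a::local_field \<Rightarrow> 'a) set" where
  "C_k k = {f. \<exists>g. continuous_on (tuples (Suc k)) g \<and>
                   (\<forall>x\<in>distinct_tuples (Suc k). g x = diff_quot k f x)}"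

definition Lipschitz_const :: "nat \<Rightarrow> ('a::local_field \<Rightarrow> 'a) \<Rightarrow> ereal" where
  "Lipschitz_const n f = (SUP x\<in>distinct_tuples (Suc n). ereal (vabs (diff_quot n f x)))"

definition nth_Lipschitz :: "nat \<Rightarrow> ('a::local_field \<Rightarrow> 'a) \<Rightarrow> bool" where
  "nth_Lipschitz n f \<longleftrightarrow> continuous_on val_ring f \<and> Lipschitz_const n f < \<infinity>"

section \<open>The wavelet expansion\<close>

context
  fixes \<pi> :: "'a::local_field" and T :: "'a set"
begin

definition reps_upto :: "nat \<Rightarrow> 'a set" where
  "reps_upto m = {\<Sum>i<m. a i * \<pi> ^ i | a. \<forall>i<m. a i \<in> T}"

definition reps :: "'a set" where
  "reps = (\<Union>m. reps_upto m)"

text \<open>The index \<open>0\<close> is excluded: \<open>trunc\<close> below only makes sense for nonzero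
  elements, and the coefficients at \<open>0\<close> do not contribute to the Lipschitz constant.\<close>

definition reps_plus :: "'a set" where
  "reps_plus = reps - {0}"

definition len :: "'a \<Rightarrow> nat" where
  "len r = (LEAST m. r \<in> reps_upto m)"

text \<open>\<open>trunc r\<close> is \<open>r\<^sub>-\<close>, i.e. \<open>r\<close> without its leading digit.\<close>

definition trunc :: "'a \<Rightarrow> 'a" where
  "trunc r = (THE s. \<exists>a m. (\<forall>i\<le>m. a i \<in> T) \<and> a m \<noteq> 0 \<and>
                r = (\<Sum>i\<le>m. a i * \<pi> ^ i) \<and> s = (\<Sum>i<m. a i * \<pi> ^ i))"

definition gam :: "'a \<Rightarrow> 'a" where
  "gam r = (if r = 0 then 1 else r - trunc r)"

definition chi :: "'a \<Rightarrow> 'a \<Rightarrow> 'a" where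
  "chi r = indicator {x. vabs (x - r) \<le> 1 / real (residue_card TYPE('a)) ^ len r}"

definition wavelet :: "nat \<Rightarrow> 'a \<Rightarrow> nat \<Rightarrow> 'a \<Rightarrow> 'a" where
  "wavelet m r j x = gam r ^ (m - j) * (x - r) ^ j * chi r x"

text \<open>
  The wavelets form an orthonormal family in \<open>C_k m\<close>. Hence, if the coefficients tend to
  \<open>0\<close>, the series converges in the norm of \<open>C_k m\<close>, and its sum there is the pointwise
  sum used below. Coefficients are set to \<open>0\<close> outside the index set, so that they are
  determined as a total function.
\<close>

definition is_expansion :: "nat \<Rightarrow> ('a \<Rightarrow> 'a) \<Rightarrow> ('a \<Rightarrow> nat \<Rightarrow> 'a) \<Rightarrow> bool" where
  "is_expansion m f b \<longleftrightarrow>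
     (\<forall>r j. (r, j) \<notin> reps \<times> {0..m} \<longrightarrow> b r j = 0) \<and>
     ((\<lambda>(r, j). b r j) \<longlongrightarrow> 0) cofinite \<and>
     (\<forall>x\<in>val_ring. ((\<lambda>(r, j). b r j * wavelet m r j x) has_sum f x) (reps \<times> {0..m}))"

definition coeff :: "nat \<Rightarrow> ('a \<Rightarrow> 'a) \<Rightarrow> 'a \<Rightarrow> nat \<Rightarrow> 'a" where
  "coeff m f = (THE b. is_expansion m f b)"

definition coeff_sup :: "nat \<Rightarrow> ('a \<Rightarrow> 'a) \<Rightarrow> ereal" where
  "coeff_sup n f =
     (SUP (r, j)\<in>reps_plus \<times> {0..n - 1}. ereal (vabs (coeff (n - 1) f r j * inverse (gam r))))"

end

end

theory Submission
  imports Defs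
begin

text \<open>
  Divided differences \<open>divdiff f S\<close> are taken over finite sets, so that they are symmetric by
  construction. The basic hypothesis on \<open>f\<close> is \<open>swap_le m f \<delta> \<epsilon>\<close>: moving one of the \<open>m + 1\<close> nodes
  by at most \<open>\<delta>\<close> changes the divided difference by at most \<open>\<epsilon>\<close>. By compactness, a suitable \<open>\<delta>\<close>
  exists for each \<open>\<epsilon>\<close> iff \<open>f\<close> is \<open>C\<^sup>m\<close>; an \<open>(m+1)\<close>-st Lipschitz constant \<open>A\<close> gives \<open>\<epsilon> = A \<delta>\<close>.

  The Taylor polynomial \<open>P\<^sub>r\<close> of degree \<open>m\<close> at \<open>r\<close> is the limit of the interpolation polynomials with
  nodes tending to \<open>r\<close>. Exchanging the nodes one by one shows that the coefficients of
  \<open>P\<^sub>r - P\<^sub>s\<close> at \<open>(x - r)\<^sup>j\<close> are bounded by \<open>\<epsilon> \<bar>r - s\<bar>\<^sup>m\<^sup>-\<^sup>j\<close>, where \<open>\<delta> = \<bar>r - s\<bar>\<close>. The wavelet coefficients of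
  \<open>f\<close> at \<open>r\<close> are, up to powers of \<open>\<gamma>\<^sub>r = r - r\<^sub>-\<close>, the coefficients of \<open>P\<^sub>r - P\<^sub>s\<close> for \<open>s = r\<^sub>-\<close>; the partial
  sums of the expansion telescope to Taylor polynomials, and \<open>\<bar>b\<^sub>r \<gamma>\<^sub>r\<inverse>\<bar> \<le> A\<close> follows. Conversely, the divided
  difference of order \<open>m + 1\<close> of a wavelet is at most \<open>\<bar>\<gamma>\<^sub>r\<inverse>\<bar>\<close> for \<open>r \<noteq> 0\<close> and vanishes for \<open>r = 0\<close>, so
  summing the expansion bounds the Lipschitz constant by \<open>sup \<bar>b\<^sub>r \<gamma>\<^sub>r\<inverse>\<bar>\<close>.
\<close>

section \<open>Divided differences over finite sets\<close>

text \<open>The Lagrange form of the divided difference of order \<open>card S - 1\<close>.\<close>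

definition divdiff :: "('a::field \<Rightarrow> 'a) \<Rightarrow> 'a set \<Rightarrow> 'a" where
  "divdiff f S = (\<Sum>a\<in>S. f a / (\<Prod>b\<in>S - {a}. a - b))"

definition interp :: "('a::field \<Rightarrow> 'a) \<Rightarrow> 'a set \<Rightarrow> 'a poly" where
  "interp f S = (\<Sum>a\<in>S. smult (f a / (\<Prod>b\<in>S - {a}. a - b)) (\<Prod>b\<in>S - {a}. [:-b, 1:]))"

lemma divdiff_empty [simp]: "divdiff f {} = 0"
  by (simp add: divdiff_def)

lemma divdiff_singleton [simp]: "divdiff f {a} = f a"
  by (simp add: divdiff_def)

lemma divdiff_cong: "(\<And>a. a \<in> S \<Longrightarrow> f a = g a) \<Longrightarrow> divdiff f S = divdiff g S"
  by (simp add: divdiff_def)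

lemma divdiff_insert:
  assumes "finite S" "a \<notin> S"
  shows "divdiff f (insert a S) =
    f a / (\<Prod>b\<in>S. a - b) + (\<Sum>c\<in>S. f c / ((c - a) * (\<Prod>b\<in>S - {c}. c - b)))"
proof -
  have "insert a S - {a} = S" using assms by auto
  moreover have "(\<Prod>b\<in>insert a S - {c}. c - b) = (c - a) * (\<Prod>b\<in>S - {c}. c - b)" if "c \<in> S" for c
  proof -
    have "insert a S - {c} = insert a (S - {c})" using assms that by auto
    then show ?thesis using assms by simp
  qed
  ultimately show ?thesis
    using assms by (simp add: divdiff_def)
qed

text \<open>The classical recursion, with \<open>S\<close> the shared nodes: at such a node 1/(c -
  a) - 1/(c - b) = (a - b)/((c - a)(c - b)), and the terms at \<open>a\<close> and \<open>b\<close>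
  match directly.\<close>

lemma divdiff_insert2:
  assumes "finite S" "a \<notin> S" "b \<notin> S" "a \<noteq> b"
  shows "divdiff f (insert a (insert b S)) = (divdiff f (insert a S) - divdiff f (insert b S)) / (a - b)"
proof -
  define Q where "Q c = (\<Prod>d\<in>S - {c}. c - d)" for c
  have nz: "(\<Prod>d\<in>S. a - d) \<noteq> 0" "(\<Prod>d\<in>S. b - d) \<noteq> 0"
    using assms by (auto simp: prod_zero_iff)
  have Q: "(\<Prod>d\<in>insert b S - {c}. c - d) = (c - b) * Q c" if "c \<in> S" for c
  proof -
    have "insert b S - {c} = insert b (S - {c})" using assms that by auto
    then show ?thesis using assms by (simp add: Q_def)
  qed
  have sb: "insert b S - {b} = S" using assms by auto
  have L: "divdiff f (insert a (insert b S)) = f a / ((a - b) * (\<Prod>d\<in>S. a - d))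
     + f b / ((b - a) * (\<Prod>d\<in>S. b - d)) + (\<Sum>c\<in>S. f c / ((c - a) * ((c - b) * Q c)))"
    using assms by (simp add: divdiff_insert Q sb)
  have R: "divdiff f (insert a S) - divdiff f (insert b S) =
     f a / (\<Prod>d\<in>S. a - d) - f b / (\<Prod>d\<in>S. b - d)
       + (\<Sum>c\<in>S. f c / ((c - a) * Q c) - f c / ((c - b) * Q c))"
    using assms by (simp add: divdiff_insert Q_def sum_subtractf)
  have "f c / ((c - a) * Q c) - f c / ((c - b) * Q c) = (a - b) * (f c / ((c - a) * ((c - b) * Q c)))"
    if "c \<in> S" for c
  proof -
    have "c - a \<noteq> 0" "c - b \<noteq> 0" "Q c \<noteq> 0"
      using assms that by (auto simp: Q_def)
    then show ?thesis by (simp add: divide_simps) (simp add: algebra_simps)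
  qed
  then have "(\<Sum>c\<in>S. f c / ((c - a) * Q c) - f c / ((c - b) * Q c))
      = (a - b) * (\<Sum>c\<in>S. f c / ((c - a) * ((c - b) * Q c)))"
    by (simp add: sum_distrib_left)
  moreover have ab: "(a - b) * (f a / ((a - b) * P)) = f a / P"
    and ba: "(a - b) * (f b / ((b - a) * P)) = - (f b / P)" if "P \<noteq> 0" for P
    using that assms(4) by (simp_all add: divide_simps) (simp_all add: algebra_simps)
  ultimately have "divdiff f (insert a S) - divdiff f (insert b S) = (a - b) * divdiff f (insert a (insert b S))"
    unfolding L R using nz by (simp add: distrib_left ab ba)
  then show ?thesis using assms(4) by simp
qed

text \<open>With at least two nodes, the recursion on two of them subtracts two equal values,
  supplied by induction on the cardinality.\<close>

lemma divdiff_const: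
  assumes "finite S"
  shows "divdiff (\<lambda>_. c) S = (if card S = 1 then c else 0)"
  using assms
proof (induction "card S" arbitrary: S rule: less_induct)
  case less
  consider "S = {}" | a where "S = {a}" | a b where "a \<in> S" "b \<in> S" "a \<noteq> b"
    by blast
  then show ?case
  proof cases
    case 3
    define S' where "S' = S - {a, b}"
    have S: "S = insert a (insert b S')" "a \<notin> S'" "b \<notin> S'" "finite S'"
      using 3 less.prems by (auto simp: S'_def)
    have "divdiff (\<lambda>_. c) (insert a S') = divdiff (\<lambda>_. c) (insert b S')"
      using S 3(3) less.hyps[of "insert a S'"] less.hyps[of "insert b S'"] by simp
    then show ?thesis using S 3(3) divdiff_insert2[of S' a b "\<lambda>_. c"] by simp
  qed auto
qed

text \<open>Write x - c = (a - c) + (x - a): the factor x - a kills the node \<open>a\<close> and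
  cancels its factor in all other denominators. This is the Leibniz rule for a linear factor, with
  \<open>a\<close> any node.\<close>

lemma divdiff_linear_mult:
  assumes "finite S" "a \<in> S"
  shows "divdiff (\<lambda>x. (x - c) * f x) S = (a - c) * divdiff f S + divdiff f (S - {a})"
proof -
  define S' where "S' = S - {a}"
  have S: "S = insert a S'" "a \<notin> S'" "finite S'" using assms by (auto simp: S'_def)
  define Q where "Q x = (\<Prod>d\<in>S' - {x}. x - d)" for x
  have "(x - c) * f x / ((x - a) * Q x) = (a - c) * (f x / ((x - a) * Q x)) + f x / Q x"
    if "x \<in> S'" for x
  proof -
    have "x - a \<noteq> 0" "Q x \<noteq> 0" using S that by (auto simp: Q_def)
    then show ?thesis by (simp add: divide_simps) (simp add: algebra_simps)
  qed
  then have "(\<Sum>x\<in>S'. (x - c) * f x / ((x - a) * Q x))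
      = (a - c) * (\<Sum>x\<in>S'. f x / ((x - a) * Q x)) + (\<Sum>x\<in>S'. f x / Q x)"
    by (simp add: sum.distrib sum_distrib_left)
  then show ?thesis
    using S by (simp add: divdiff_insert Q_def[symmetric] distrib_left) (simp add: divdiff_def Q_def)
qed

text \<open>Peeling off one linear factor by the Leibniz rule loses at most one node, so the
  condition on the cardinality survives the induction.\<close>

lemma divdiff_monomial_eq_0:
  assumes "finite S" "card S > Suc j"
  shows "divdiff (\<lambda>x. (x - c) ^ j) S = 0"
  using assms
proof (induction j arbitrary: S)
  case 0
  then show ?case using divdiff_const[of S 1] by simp
next
  case (Suc j)
  then obtain a where a: "a \<in> S" by fastforce
  then show ?case
    using Suc divdiff_linear_mult[OF Suc.prems(1) a, of c "\<lambda>x. (x - c) ^ j"]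
    by (simp add: card_Diff_singleton)
qed

section \<open>Newton form of the interpolation polynomial\<close>

lemma interp_insert:
  assumes "finite S" "a \<notin> S"
  shows "interp f (insert a S) = interp f S + smult (divdiff f (insert a S)) (\<Prod>c\<in>S. [:-c, 1:])"
proof -
  define Q where "Q c = (\<Prod>d\<in>S - {c}. c - d)" for c
  define R where "R c = (\<Prod>d\<in>S - {c}. [:-d, 1:])" for c
  have sa: "insert a S - {a} = S" using assms by auto
  have eq: "insert a S - {c} = insert a (S - {c})" if "c \<in> S" for c using assms that by auto
  have Q: "(\<Prod>d\<in>insert a S - {c}. c - d) = (c - a) * Q c" if "c \<in> S" for c
    using that assms by (simp add: Q_def eq)
  have R: "(\<Prod>d\<in>insert a S - {c}. [:-d, 1:]) = [:-a, 1:] * R c" if "c \<in> S" for c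
    using that assms by (simp add: R_def eq)
  have prodS: "(\<Prod>d\<in>S. [:-d, 1:]) = [:-c, 1:] * R c" if "c \<in> S" for c
    using that assms by (simp add: R_def prod.remove)
  have step: "smult (f c / ((c - a) * Q c)) ([:-a, 1:] * R c) =
      smult (f c / Q c) (R c) + smult (f c / ((c - a) * Q c)) (\<Prod>d\<in>S. [:-d, 1:])" if "c \<in> S" for c
  proof -
    have nz: "c - a \<noteq> 0" "Q c \<noteq> 0" using assms that by (auto simp: Q_def)
    \<comment> \<open>The two linear factors differ by the constant c - a. This turns the Lagrange
      basis of the enlarged node set into the old one plus a multiple of the nodal polynomial of
      \<open>S\<close>.\<close>
    have "[:-a, 1:] * R c = [:-c, 1:] * R c + smult (c - a) (R c)"
      by (simp add: algebra_simps flip: smult_add_left)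
    then show ?thesis using nz
      by (simp add: prodS[OF that] smult_add_right del: mult_pCons_left)
  qed
  have "interp f (insert a S) = smult (f a / (\<Prod>b\<in>S. a - b)) (\<Prod>c\<in>S. [:-c, 1:])
      + (\<Sum>c\<in>S. smult (f c / ((c - a) * Q c)) ([:-a, 1:] * R c))"
    using assms by (simp add: interp_def sa Q R del: mult_pCons_left)
  also have "(\<Sum>c\<in>S. smult (f c / ((c - a) * Q c)) ([:-a, 1:] * R c)) =
      interp f S + smult (\<Sum>c\<in>S. f c / ((c - a) * Q c)) (\<Prod>d\<in>S. [:-d, 1:])"
    by (simp add: step sum.distrib smult_sum del: mult_pCons_left) (simp add: interp_def Q_def R_def)
  finally show ?thesis
    using assms by (simp add: divdiff_insert Q_def smult_add_left)
qed

text \<open>In Newton's form the interpolant on \<open>S\<close> cancels, leaving a multiple of the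
  nodal polynomial of the shared nodes. Exchanges in divided differences thus control the whole
  polynomial.\<close>

lemma interp_swap:
  assumes "finite S" "a \<notin> S" "b \<notin> S"
  shows "interp f (insert a S) - interp f (insert b S) =
     smult (divdiff f (insert a S) - divdiff f (insert b S)) (\<Prod>c\<in>S. [:-c, 1:])"
  using assms by (simp add: interp_insert smult_diff_left)

lemma poly_interp:
  assumes "finite S" "a \<in> S"
  shows "poly (interp f S) a = f a"
proof -
  have *: "(\<Prod>b\<in>S - {c}. a - b) = 0" if "c \<in> S" "c \<noteq> a" for c
    using that assms by (auto simp: prod_zero_iff)
  have "poly (interp f S) a = (\<Sum>c\<in>S. f c / (\<Prod>b\<in>S - {c}. c - b) * (\<Prod>b\<in>S - {c}. a - b))"
    by (simp add: interp_def poly_sum poly_prod)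
  also have "\<dots> = (\<Sum>c\<in>S. if c = a then f a else 0)"
    using assms by (intro sum.cong refl) (auto simp: *)
  finally show ?thesis using assms by simp
qed

lemma degree_prod_linear: "finite S \<Longrightarrow> degree (\<Prod>c\<in>S. [:- c :: 'a::field, 1:]) = card S"
  by (subst degree_prod_eq_sum_degree) auto

lemma degree_interp:
  assumes "finite S"
  shows "degree (interp f S) \<le> card S - 1"
  unfolding interp_def
proof (rule degree_sum_le[OF assms])
  fix a assume "a \<in> S"
  then have "degree (\<Prod>b\<in>S - {a}. [:-b, 1:]) = card S - 1"
    using assms by (simp add: degree_prod_linear del: degree_pCons_eq_if)
  then show "degree (smult (f a / (\<Prod>b\<in>S - {a}. a - b)) (\<Prod>b\<in>S - {a}. [:-b, 1:])) \<le> card S - 1"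
    by (metis degree_smult_le)
qed

lemma coeff_interp:
  assumes "finite S" "card S = Suc k"
  shows "poly.coeff (interp f S) k = divdiff f S"
proof -
  have "poly.coeff (\<Prod>b\<in>S - {a}. [:-b, 1:]) k = 1" if "a \<in> S" for a
  proof -
    have "degree (\<Prod>b\<in>S - {a}. [:-b, 1:]) = k"
      using assms that by (subst degree_prod_linear) auto
    moreover have "lead_coeff (\<Prod>b\<in>S - {a}. [:-b, 1:]) = 1"
      by (simp add: lead_coeff_prod)
    ultimately show ?thesis by simp
  qed
  then show ?thesis by (simp add: interp_def divdiff_def coeff_sum)
qed

section \<open>Non-archimedean fields\<close>

lemma vabs_nonneg [simp]: "0 \<le> vabs (x :: 'a::nonarch_field)"
  by (metis diff_zero dist_eq_vabs zero_le_dist)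

lemma vabs_eq_0_iff [simp]: "vabs (x :: 'a::nonarch_field) = 0 \<longleftrightarrow> x = 0"
  by (metis diff_zero dist_eq_0_iff dist_eq_vabs)

lemma vabs_pos_iff [simp]: "0 < vabs (x :: 'a::nonarch_field) \<longleftrightarrow> x \<noteq> 0"
  by (metis order_less_le vabs_eq_0_iff vabs_nonneg)

lemma vabs_0 [simp]: "vabs (0 :: 'a::nonarch_field) = 0"
  by simp

lemma vabs_1 [simp]: "vabs (1 :: 'a::nonarch_field) = 1"
  by (metis mult.right_neutral mult_cancel_left vabs_eq_0_iff vabs_times zero_neq_one)

lemma vabs_minus_commute: "vabs (x - y) = vabs (y - x :: 'a::nonarch_field)"
  by (metis dist_commute dist_eq_vabs)

lemma vabs_minus [simp]: "vabs (- x) = vabs (x :: 'a::nonarch_field)"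
  by (metis diff_0 diff_zero vabs_minus_commute)

lemma vabs_power: "vabs ((x :: 'a::nonarch_field) ^ k) = vabs x ^ k"
  by (induction k) (simp_all add: vabs_times)

lemma vabs_inverse: "vabs (inverse (x :: 'a::nonarch_field)) = inverse (vabs x)"
proof (cases "x = 0")
  case False
  then have "vabs x * vabs (inverse x) = 1" by (simp flip: vabs_times)
  then show ?thesis by (simp add: inverse_unique)
qed simp

lemma vabs_divide: "vabs ((x :: 'a::nonarch_field) / y) = vabs x / vabs y"
  by (simp add: divide_inverse vabs_times vabs_inverse)

lemma vabs_prod: "vabs (\<Prod>i\<in>A. f i :: 'a::nonarch_field) = (\<Prod>i\<in>A. vabs (f i))"
  by (induction A rule: infinite_finite_induct) (simp_all add: vabs_times)

lemma vabs_plus_le: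
  fixes x y :: "'a::nonarch_field"
  shows "vabs x \<le> B \<Longrightarrow> vabs y \<le> B \<Longrightarrow> vabs (x + y) \<le> B"
  using vabs_plus_le_max[of x y] by linarith

lemma vabs_minus_le:
  fixes x y :: "'a::nonarch_field"
  shows "vabs x \<le> B \<Longrightarrow> vabs y \<le> B \<Longrightarrow> vabs (x - y) \<le> B"
  using vabs_plus_le[of x B "- y"] by simp

lemma vabs_diff_trans_le:
  fixes x y :: "'a::nonarch_field"
  shows "vabs (x - y) \<le> B \<Longrightarrow> vabs (y - z) \<le> B \<Longrightarrow> vabs (x - z) \<le> B"
  using vabs_plus_le[of "x - y" B "y - z"] by simp

lemma vabs_eq_if_diff_less:
  fixes x y :: "'a::nonarch_field"
  assumes "vabs (x - y) < vabs y"
  shows "vabs x = vabs y"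
proof (rule antisym)
  show "vabs x \<le> vabs y" using vabs_plus_le[of "x - y" "vabs y" y] assms by simp
  show "vabs y \<le> vabs x"
    using vabs_plus_le_max[of "y - x" x] assms by (simp add: vabs_minus_commute[of y])
qed

lemma vabs_sum_le:
  fixes f :: "'b \<Rightarrow> 'a::nonarch_field"
  assumes "\<And>i. i \<in> A \<Longrightarrow> vabs (f i) \<le> B" "0 \<le> B"
  shows "vabs (sum f A) \<le> B"
  using assms by (induction A rule: infinite_finite_induct) (auto intro: vabs_plus_le)

section \<open>Limits and sums in a non-archimedean field\<close>

lemma tendsto_vabs_iff:
  fixes f :: "'b \<Rightarrow> 'a::nonarch_field"
  shows "(f \<longlongrightarrow> l) F \<longleftrightarrow> ((\<lambda>x. vabs (f x - l)) \<longlongrightarrow> 0) F"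
  by (subst tendsto_dist_iff) (simp add: dist_eq_vabs)

lemma tendsto_vabs:
  fixes f :: "'b \<Rightarrow> 'a::nonarch_field"
  assumes "(f \<longlongrightarrow> l) F"
  shows "((\<lambda>x. vabs (f x)) \<longlongrightarrow> vabs l) F"
  using tendsto_dist[OF assms tendsto_const[of 0]] by (simp add: dist_eq_vabs)

text \<open>The class supplies only a metric; continuity of the operations opens the general rules
  for limits and for \<open>has_sum\<close>.\<close>

instance nonarch_field \<subseteq> topological_ab_group_add
proof
  fix a b :: 'a
  show "((\<lambda>x. fst x + snd x) \<longlongrightarrow> a + b) (nhds a \<times>\<^sub>F nhds b)"
    unfolding nhds_prod[symmetric] tendsto_vabs_iff
  proof (rule tendsto_sandwich[where f = "\<lambda>_. 0"])
    show "\<forall>\<^sub>F x in nhds (a, b). vabs (fst x + snd x - (a + b)) \<le> vabs (fst x - a) + vabs (snd x - b)"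
    proof (rule always_eventually, rule allI)
      fix x :: "'a \<times> 'a"
      have "vabs ((fst x - a) + (snd x - b)) \<le> vabs (fst x - a) + vabs (snd x - b)"
        by (rule vabs_plus_le) auto
      then show "vabs (fst x + snd x - (a + b)) \<le> vabs (fst x - a) + vabs (snd x - b)"
        by (simp add: algebra_simps)
    qed
    have "((\<lambda>x. dist (fst x) a + dist (snd x) b) \<longlongrightarrow> dist (fst (a, b)) a + dist (snd (a, b)) b) (nhds (a, b))"
      by (intro tendsto_intros filterlim_ident)
    then show "((\<lambda>x. vabs (fst x - a) + vabs (snd x - b)) \<longlongrightarrow> 0) (nhds (a, b))"
      by (simp add: dist_eq_vabs)
  qed auto
  have "((\<lambda>x. dist a x) \<longlongrightarrow> dist a a) (nhds a)"
    by (intro tendsto_intros filterlim_ident)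
  then show "(uminus \<longlongrightarrow> - a) (nhds a)"
    unfolding tendsto_vabs_iff by (simp add: dist_eq_vabs)
qed

instance nonarch_field \<subseteq> topological_comm_monoid_mult
proof
  fix a b :: 'a
  show "((\<lambda>x. fst x * snd x) \<longlongrightarrow> a * b) (nhds a \<times>\<^sub>F nhds b)"
    unfolding nhds_prod[symmetric] tendsto_vabs_iff
  proof (rule tendsto_sandwich[where f = "\<lambda>_. 0"])
    show "\<forall>\<^sub>F x in nhds (a, b). vabs (fst x * snd x - a * b) \<le>
        vabs (fst x) * vabs (snd x - b) + vabs (fst x - a) * vabs b"
    proof (rule always_eventually, rule allI)
      fix x :: "'a \<times> 'a"
      have "vabs (fst x * (snd x - b) + (fst x - a) * b) \<le> vabs (fst x) * vabs (snd x - b) + vabs (fst x - a) * vabs b"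
        by (rule vabs_plus_le) (auto simp: vabs_times)
      then show "vabs (fst x * snd x - a * b) \<le> vabs (fst x) * vabs (snd x - b) + vabs (fst x - a) * vabs b"
        by (simp add: algebra_simps)
    qed
    have "((\<lambda>x. dist (fst x) 0 * dist (snd x) b + dist (fst x) a * vabs b) \<longlongrightarrow>
        dist (fst (a, b)) 0 * dist (snd (a, b)) b + dist (fst (a, b)) a * vabs b) (nhds (a, b))"
      by (intro tendsto_intros filterlim_ident)
    then show "((\<lambda>x. vabs (fst x) * vabs (snd x - b) + vabs (fst x - a) * vabs b) \<longlongrightarrow> 0) (nhds (a, b))"
      by (simp add: dist_eq_vabs)
  qed auto
qed

text \<open>By the ultrametric inequality, small consecutive steps keep all later terms close to one
  another, whatever their number.\<close>

lemma convergent_if_steps_tendsto_0: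
  fixes u :: "nat \<Rightarrow> 'a::nonarch_field"
  assumes "(\<lambda>t. u (Suc t) - u t) \<longlonglongrightarrow> 0"
  shows "convergent u"
proof (rule Cauchy_convergent, rule metric_CauchyI)
  fix e :: real assume "e > 0"
  then obtain M where M: "\<And>t. t \<ge> M \<Longrightarrow> vabs (u (Suc t) - u t) < e / 2"
    using assms[unfolded tendsto_iff, rule_format, of "e / 2"]
    unfolding eventually_sequentially by (auto simp: dist_eq_vabs)
  have *: "vabs (u (M + k) - u M) \<le> e / 2" for k
  proof (induction k)
    case (Suc k)
    show ?case
      by (rule vabs_diff_trans_le[OF _ Suc]) (use M[of "M + k"] in simp)
  qed (use \<open>e > 0\<close> in simp)
  have "dist (u m) (u n) < e" if "m \<ge> M" "n \<ge> M" for m n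
  proof -
    have "vabs (u m - u M) \<le> e / 2" "vabs (u M - u n) \<le> e / 2"
      using *[of "m - M"] *[of "n - M"] that vabs_minus_commute[of "u M" "u n"] by simp_all
    then have "vabs (u m - u n) \<le> e / 2" by (rule vabs_diff_trans_le)
    then show ?thesis using \<open>e > 0\<close> by (simp add: dist_eq_vabs)
  qed
  then show "\<exists>M. \<forall>m\<ge>M. \<forall>n\<ge>M. dist (u m) (u n) < e" by blast
qed

text \<open>Finite partial sums obey the bound of their terms by the ultrametric inequality, and the
  bound passes to the limit.\<close>

lemma has_sum_vabs_le:
  fixes f :: "'b \<Rightarrow> 'a::nonarch_field"
  assumes "(f has_sum s) A" "\<And>a. a \<in> A \<Longrightarrow> vabs (f a) \<le> B" "0 \<le> B"
  shows "vabs s \<le> B"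
proof (rule tendsto_upperbound)
  show "((\<lambda>F. vabs (sum f F)) \<longlongrightarrow> vabs s) (finite_subsets_at_top A)"
    using assms(1) unfolding has_sum_def by (rule tendsto_vabs)
  show "\<forall>\<^sub>F F in finite_subsets_at_top A. vabs (sum f F) \<le> B"
    using assms(2,3) by (intro eventually_finite_subsets_at_top_weakI vabs_sum_le) auto
qed simp

lemma has_sum_finite_sum:
  fixes f :: "'b \<Rightarrow> 'c \<Rightarrow> 'a::topological_comm_monoid_add"
  assumes "\<And>a. a \<in> S \<Longrightarrow> (f a has_sum s a) A"
  shows "((\<lambda>i. \<Sum>a\<in>S. f a i) has_sum (\<Sum>a\<in>S. s a)) A"
  using assms by (induction S rule: infinite_finite_induct) (auto intro: has_sum_0 has_sum_add)

section \<open>Polynomials over non-archimedean fields\<close>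

text \<open>Composition with \<open>[:r, 1:]\<close> recentres at \<open>r\<close>: x - c becomes x
  + (r - c), so each factor either raises the index or contributes at most \<rho>. The inequality is
  free of division in order to cover \<rho> = 0.\<close>

lemma vabs_coeff_prod_linear:
  fixes r :: "'a::nonarch_field"
  assumes "finite S" "\<And>c. c \<in> S \<Longrightarrow> vabs (r - c) \<le> \<rho>" "0 \<le> \<rho>"
  shows "vabs (poly.coeff (pcompose (\<Prod>c\<in>S. [:-c, 1:]) [:r, 1:]) j) * \<rho> ^ j \<le> \<rho> ^ card S"
  using assms
proof (induction S arbitrary: j rule: finite_induct)
  case empty
  then show ?case by (cases j) (simp_all add: pcompose_1)
next
  case (insert a S)
  define p where "p = pcompose (\<Prod>c\<in>S. [:-c, 1:]) [:r, 1:]"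
  have IH: "vabs (poly.coeff p j) * \<rho> ^ j \<le> \<rho> ^ card S" for j
    using insert by (simp add: p_def)
  have "pcompose (\<Prod>c\<in>insert a S. [:-c, 1:]) [:r, 1:] = pcompose [:-a, 1:] [:r, 1:] * p"
    using insert.hyps by (simp add: pcompose_mult p_def del: mult_pCons_left)
  also have "pcompose [:-a, 1:] [:r, 1:] = [:r - a, 1:]"
    by (simp add: pcompose_pCons)
  finally have eq: "poly.coeff (pcompose (\<Prod>c\<in>insert a S. [:-c, 1:]) [:r, 1:]) j =
      (r - a) * poly.coeff p j + (if j = 0 then 0 else poly.coeff p (j - 1))" (is "_ = ?x + ?y")
    by (cases j) (simp_all only: mult_pCons_left coeff_add coeff_smult coeff_pCons_0 coeff_pCons_Suc, simp_all)
  have "vabs (r - a) * (vabs (poly.coeff p j) * \<rho> ^ j) \<le> \<rho> * \<rho> ^ card S"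
    using insert by (intro mult_mono IH) auto
  then have x: "vabs ?x * \<rho> ^ j \<le> \<rho> ^ Suc (card S)"
    by (simp add: vabs_times mult.assoc)
  have y: "vabs ?y * \<rho> ^ j \<le> \<rho> ^ Suc (card S)"
  proof (cases j)
    case (Suc i)
    show ?thesis
      using mult_left_mono[OF IH[of i] insert.prems(2)] by (simp add: Suc mult.left_commute)
  qed (use insert.prems in simp)
  have "vabs (?x + ?y) * \<rho> ^ j \<le> max (vabs ?x) (vabs ?y) * \<rho> ^ j"
    using insert.prems by (intro mult_right_mono vabs_plus_le_max) auto
  also have "\<dots> \<le> \<rho> ^ Suc (card S)"
    by (metis x y max_def)
  finally have "vabs (?x + ?y) * \<rho> ^ j \<le> \<rho> ^ Suc (card S)" .
  then have "vabs (poly.coeff (pcompose (\<Prod>c\<in>insert a S. [:-c, 1:]) [:r, 1:]) j) * \<rho> ^ j \<le> \<rho> ^ Suc (card S)"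
    by (simp only: eq)
  then show ?case by (simp only: card_insert_disjoint[OF insert.hyps])
qed

section \<open>Limits of polynomials\<close>

lemma tendsto_poly_arg:
  fixes q :: "'a::nonarch_field poly"
  assumes "(f \<longlongrightarrow> x) F"
  shows "((\<lambda>k. poly q (f k)) \<longlongrightarrow> poly q x) F"
  by (induction q) (auto intro!: tendsto_add tendsto_mult assms)

text \<open>Under a common degree bound this is convergence in a finite-dimensional space, so it
  passes to evaluation and substitution.\<close>

definition coeffwise_lim :: "(nat \<Rightarrow> 'a::{zero,topological_space} poly) \<Rightarrow> 'a poly \<Rightarrow> bool" where
  "coeffwise_lim P p \<longleftrightarrow> (\<forall>j. (\<lambda>t. poly.coeff (P t) j) \<longlonglongrightarrow> poly.coeff p j)"

lemma coeffwise_lim_poly: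
  fixes P :: "nat \<Rightarrow> 'a::nonarch_field poly"
  assumes "coeffwise_lim P p" "\<And>t. degree (P t) \<le> d" "degree p \<le> d"
  shows "(\<lambda>t. poly (P t) x) \<longlonglongrightarrow> poly p x"
proof -
  have "poly q x = (\<Sum>i\<le>d. poly.coeff q i * x ^ i)" if "degree q \<le> d" for q
    unfolding poly_altdef using that by (intro sum.mono_neutral_left) (auto simp: coeff_eq_0)
  moreover have "(\<lambda>t. \<Sum>i\<le>d. poly.coeff (P t) i * x ^ i) \<longlonglongrightarrow> (\<Sum>i\<le>d. poly.coeff p i * x ^ i)"
    using assms(1) unfolding coeffwise_lim_def by (intro tendsto_intros) auto
  ultimately show ?thesis using assms by simp
qed

text \<open>The coefficients of \<open>pcompose p q\<close> are finite linear combinations of those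
  of \<open>p\<close>, with weights depending on \<open>q\<close> only.\<close>

lemma coeffwise_lim_pcompose:
  fixes P :: "nat \<Rightarrow> 'a::nonarch_field poly"
  assumes "coeffwise_lim P p" "\<And>t. degree (P t) \<le> d" "degree p \<le> d"
  shows "coeffwise_lim (\<lambda>t. pcompose (P t) q) (pcompose p q)"
proof -
  have mono: "pcompose (monom c i) q = smult c (q ^ i)" for c :: 'a and i
    by (induction i) (simp_all add: monom_Suc pcompose_pCons monom_0 pcompose_const)
  have "pcompose r q = (\<Sum>i\<le>d. smult (poly.coeff r i) (q ^ i))" if "degree r \<le> d" for r
  proof -
    have "pcompose r q = pcompose (\<Sum>i\<le>d. monom (poly.coeff r i) i) q"
      by (simp only: poly_as_sum_of_monoms'[OF that])
    also have "\<dots> = (\<Sum>i\<le>d. pcompose (monom (poly.coeff r i) i) q)"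
      by (rule pcompose_sum)
    finally show ?thesis by (simp add: mono)
  qed
  moreover have "(\<lambda>t. \<Sum>i\<le>d. poly.coeff (P t) i * poly.coeff (q ^ i) j)
      \<longlonglongrightarrow> (\<Sum>i\<le>d. poly.coeff p i * poly.coeff (q ^ i) j)" for j
    using assms(1) unfolding coeffwise_lim_def by (intro tendsto_intros) auto
  ultimately show ?thesis using assms by (simp add: coeffwise_lim_def coeff_sum)
qed

lemma coeffwise_lim_diff:
  fixes P :: "nat \<Rightarrow> 'a::nonarch_field poly"
  assumes "coeffwise_lim P p" "coeffwise_lim Q q"
  shows "coeffwise_lim (\<lambda>t. P t - Q t) (p - q)"
  using assms unfolding coeffwise_lim_def by (auto intro: tendsto_intros)

lemma coeffwise_lim_exists:
  fixes P :: "nat \<Rightarrow> 'a::nonarch_field poly"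
  assumes "\<And>t. degree (P t) \<le> d" "\<And>j. convergent (\<lambda>t. poly.coeff (P t) j)"
  shows "\<exists>p. coeffwise_lim P p \<and> degree p \<le> d"
proof -
  define l where "l j = lim (\<lambda>t. poly.coeff (P t) j)" for j
  have l: "(\<lambda>t. poly.coeff (P t) j) \<longlonglongrightarrow> l j" for j
    using assms(2)[of j] by (simp add: l_def convergent_LIMSEQ_iff)
  have l0: "l j = 0" if "j > d" for j
  proof -
    have "poly.coeff (P t) j = 0" for t
      using assms(1)[of t] that by (simp add: coeff_eq_0)
    then show ?thesis by (simp add: l_def limI)
  qed
  define p where "p = (\<Sum>i\<le>d. monom (l i) i)"
  have p: "poly.coeff p j = l j" for j
    using l0[of j] by (auto simp: p_def coeff_sum not_le)
  then have "degree p \<le> d" using l0 by (intro degree_le) auto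
  then show ?thesis using l by (intro exI[of _ p]) (simp add: coeffwise_lim_def p)
qed

text \<open>Split off the full power x^j at 0, leaving \<open>q\<close> with q(0) \<noteq> 0 and j
  \<le> d. Smallness of order d along the powers of \<open>c\<close> forces |q(c^k)| \<le>
  \<epsilon>, and the limit gives q(0) = 0. Serves the uniqueness of the expansion.\<close>

lemma poly_eq_0_if_small:
  fixes p :: "'a::nonarch_field poly"
  assumes "degree p \<le> d" "c \<noteq> 0" "vabs c < 1"
    and small: "\<And>\<epsilon>. 0 < \<epsilon> \<Longrightarrow> \<forall>\<^sub>F k in sequentially. vabs (poly p (c ^ k)) \<le> \<epsilon> * vabs c ^ (k * d)"
  shows "p = 0"
proof (rule ccontr)
  assume "p \<noteq> 0"
  then obtain j q where q: "p = monom 1 j * q" "poly q 0 \<noteq> 0"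
  proof -
    assume *: "\<And>j q. p = monom 1 j * q \<Longrightarrow> poly q 0 \<noteq> 0 \<Longrightarrow> thesis"
    from order_decomp[OF \<open>p \<noteq> 0\<close>, of 0] obtain q where "p = [:-0, 1:] ^ order 0 p * q" "\<not> [:-0, 1:] dvd q" by blast
    then show thesis by (intro *[of "order 0 p" q]) (simp_all add: monom_altdef poly_eq_0_iff_dvd)
  qed
  have "q \<noteq> 0" using q by auto
  then have "degree p = j + degree q" unfolding q(1) by (subst degree_mult_eq) (auto simp: degree_monom_eq)
  then have j: "j \<le> d" using assms(1) by simp
  have c0: "(\<lambda>k. c ^ k) \<longlonglongrightarrow> 0"
    unfolding tendsto_vabs_iff using assms(3) by (simp add: vabs_power LIMSEQ_realpow_zero)
  have "(\<lambda>k. poly q (c ^ k)) \<longlonglongrightarrow> poly q 0"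
    by (rule tendsto_poly_arg[OF c0])
  then have lim: "(\<lambda>k. vabs (poly q (c ^ k))) \<longlonglongrightarrow> vabs (poly q 0)"
    by (rule tendsto_vabs)
  have "vabs (poly q 0) \<le> \<epsilon>" if "0 < \<epsilon>" for \<epsilon>
  proof (rule tendsto_upperbound[OF lim _ sequentially_bot])
    show "\<forall>\<^sub>F k in sequentially. vabs (poly q (c ^ k)) \<le> \<epsilon>"
      using small[OF that]
    proof eventually_elim
      case (elim k)
      have pos: "0 < vabs c ^ (k * j)" using assms(2) by simp
      have "vabs c ^ (k * j) * vabs (poly q (c ^ k)) \<le> \<epsilon> * vabs c ^ (k * d)"
        using elim by (simp add: q(1) poly_monom vabs_times vabs_power power_mult)
      also have "\<dots> \<le> \<epsilon> * vabs c ^ (k * j)"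
        using j assms(3) that by (intro mult_left_mono power_decreasing) auto
      finally show ?case using pos by (simp add: mult.commute)
    qed
  qed
  then have "vabs (poly q 0) \<le> 0" by (meson dense_ge)
  then show False using q(2) vabs_eq_0_iff[of "poly q 0"] vabs_nonneg[of "poly q 0"] by linarith
qed

section \<open>Digit expansions\<close>

lemma val_ring_iff: "x \<in> val_ring \<longleftrightarrow> vabs x \<le> 1"
  by (simp add: val_ring_def)

lemma max_ideal_iff: "x \<in> max_ideal \<longleftrightarrow> vabs x < 1"
  by (simp add: max_ideal_def)

lemma uniformizer_vabs_le:
  fixes \<pi> y :: "'a::nonarch_field"
  assumes "uniformizer \<pi>" "vabs y < 1"
  shows "vabs y \<le> vabs \<pi>"
proof -
  obtain z where "y = \<pi> * z" "vabs z \<le> 1"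
    using assms unfolding uniformizer_def max_ideal_def val_ring_def by blast
  then show ?thesis by (simp add: vabs_times mult_left_le)
qed

lemma uniformizer_vabs_less_1:
  fixes \<pi> :: "'a::nonarch_field"
  assumes "uniformizer \<pi>"
  shows "vabs \<pi> < 1"
proof -
  have "\<pi> * 1 \<in> (\<lambda>y. \<pi> * y) ` val_ring" by (intro imageI) (simp add: val_ring_iff)
  then show ?thesis using assms by (simp add: uniformizer_def max_ideal_iff flip: max_ideal_iff)
qed

lemma residue_field_nonempty: "(residue_field :: 'a::nonarch_field set set) \<noteq> {}"
proof -
  have "(0::'a) \<in> val_ring" by (simp add: val_ring_iff)
  then show ?thesis unfolding residue_field_def quotient_def by blast
qed

text \<open>Any two uniformizers have the same absolute value, so the normalisation given for one
  holds for all.\<close>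

lemma vabs_uniformizer:
  fixes \<pi> :: "'a::local_field"
  assumes "uniformizer \<pi>"
  shows "vabs \<pi> = 1 / real (residue_card TYPE('a))"
proof -
  obtain \<pi>' :: 'a where \<pi>': "uniformizer \<pi>'" "vabs \<pi>' = 1 / real (residue_card TYPE('a))"
    using ex_uniformizer by blast
  have "vabs \<pi> = vabs \<pi>'"
    using assms \<pi>'(1) by (intro antisym uniformizer_vabs_le uniformizer_vabs_less_1)
  then show ?thesis using \<pi>' by simp
qed

text \<open>The residue field is finite and nonempty, so 1 / q is not the degenerate 1 / 0 =
  0.\<close>

lemma uniformizer_nonzero:
  fixes \<pi> :: "'a::local_field"
  assumes "uniformizer \<pi>"
  shows "\<pi> \<noteq> 0"
proof -
  have "residue_card TYPE('a) > 0"
    using residue_field_nonempty finite_residue_field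
    unfolding residue_card_def by (simp add: card_gt_0_iff)
  then have "vabs \<pi> > 0" using vabs_uniformizer[OF assms] by simp
  then show ?thesis by simp
qed

text \<open>Distinct representatives lie in distinct residue classes, so \<open>T\<close> embeds
  into the finite residue field.\<close>

lemma finite_residue_reps:
  fixes T :: "'a::local_field set"
  assumes "residue_reps T"
  shows "finite T"
proof (rule inj_on_finite)
  define R where "R = {(x::'a, y). x \<in> val_ring \<and> y \<in> val_ring \<and> x - y \<in> max_ideal}"
  have T: "T \<subseteq> val_ring" using assms by (simp add: residue_reps_def)
  show "(\<lambda>t. R `` {t}) ` T \<subseteq> residue_field"
    using T unfolding residue_field_def R_def[symmetric] by (auto intro: quotientI)
  show "inj_on (\<lambda>t. R `` {t}) T"
  proof (rule inj_onI)
    fix s t assume st: "s \<in> T" "t \<in> T" "R `` {s} = R `` {t}"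
    then have "t \<in> R `` {t}" using T by (auto simp: R_def max_ideal_iff)
    then have "s - t \<in> max_ideal" using st by (auto simp: R_def)
    moreover have "s - s \<in> max_ideal" by (simp add: max_ideal_iff)
    moreover have "s \<in> val_ring" using st T by blast
    then have "\<exists>!u. u \<in> T \<and> s - u \<in> max_ideal"
      using assms unfolding residue_reps_def by blast
    ultimately show "s = t" using st by blast
  qed
  show "finite (residue_field :: 'a set set)" by (rule finite_residue_field)
qed

locale digit_system =
  fixes \<pi> :: "'a::local_field" and T :: "'a set"
  assumes uniformizer: "uniformizer \<pi>" and residue_reps: "residue_reps T"
begin

lemma pi_nonzero [simp]: "\<pi> \<noteq> 0"
  by (rule uniformizer_nonzero[OF uniformizer])

lemma vabs_pi_less_1: "vabs \<pi> < 1"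
  by (rule uniformizer_vabs_less_1[OF uniformizer])

lemma vabs_pi_le_1: "vabs \<pi> \<le> 1"
  using vabs_pi_less_1 by simp

lemma vabs_pi_power_mono: "i \<le> j \<Longrightarrow> vabs \<pi> ^ j \<le> vabs \<pi> ^ i"
  using vabs_pi_le_1 by (intro power_decreasing) auto

lemma vabs_pi_power_strict_mono: "i < j \<Longrightarrow> vabs \<pi> ^ j < vabs \<pi> ^ i"
  using vabs_pi_less_1 by (intro power_strict_decreasing) auto

lemma vabs_pi_power_le_1: "vabs \<pi> ^ j \<le> 1"
  using vabs_pi_power_mono[of 0 j] by simp

lemma vabs_pi_power_tendsto_0: "(\<lambda>t. vabs \<pi> ^ t) \<longlonglongrightarrow> 0"
  using vabs_pi_less_1 by (intro LIMSEQ_realpow_zero) auto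

lemma vabs_pi_power_less:
  assumes "(\<delta>::real) > 0"
  obtains k where "vabs \<pi> ^ k < \<delta>"
  using real_arch_pow_inv[OF assms vabs_pi_less_1] by blast

text \<open>Discreteness of the valuation: after division by \<open>\<pi> ^ k\<close> the element
  lies in the maximal ideal, hence is a multiple of \<pi>.\<close>

lemma vabs_less_pi_power:
  fixes x :: 'a
  assumes "vabs x < vabs \<pi> ^ k"
  shows "vabs x \<le> vabs \<pi> ^ Suc k"
proof -
  have "vabs (x / \<pi> ^ k) < 1" using assms by (simp add: vabs_divide vabs_power)
  then have "vabs (x / \<pi> ^ k) \<le> vabs \<pi>" by (rule uniformizer_vabs_le[OF uniformizer])
  then show ?thesis by (simp add: vabs_divide vabs_power field_simps)
qed

lemma chi_eq: "chi \<pi> T r x = (if vabs (x - r) \<le> vabs \<pi> ^ len \<pi> T r then 1 else 0)"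
  by (simp add: chi_def indicator_def vabs_uniformizer[OF uniformizer] power_one_over)

lemma T_val_ring: "t \<in> T \<Longrightarrow> vabs t \<le> 1"
  using residue_reps by (auto simp: residue_reps_def val_ring_iff)

lemma zero_in_T: "0 \<in> T"
  using residue_reps by (simp add: residue_reps_def)

lemma T_eqI:
  assumes "s \<in> T" "t \<in> T" "vabs (s - t) < 1"
  shows "s = t"
proof -
  have "s \<in> val_ring" using assms residue_reps unfolding residue_reps_def by blast
  then have "\<exists>!u. u \<in> T \<and> s - u \<in> max_ideal"
    using residue_reps unfolding residue_reps_def by blast
  moreover have "s - s \<in> max_ideal" "s - t \<in> max_ideal" using assms by (auto simp: max_ideal_iff)
  ultimately show ?thesis using assms by blast
qed

lemma vabs_T: "t \<in> T \<Longrightarrow> t \<noteq> 0 \<Longrightarrow> vabs t = 1"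
  using T_eqI[of t 0] zero_in_T T_val_ring[of t] by fastforce

section \<open>Finite digit expansions\<close>

lemma reps_upto_0 [simp]: "reps_upto \<pi> T 0 = {0}"
  by (auto simp: reps_upto_def)

lemma reps_upto_Suc: "reps_upto \<pi> T (Suc m) = (\<lambda>(s, a). s + a * \<pi> ^ m) ` (reps_upto \<pi> T m \<times> T)"
proof safe
  fix r assume "r \<in> reps_upto \<pi> T (Suc m)"
  then obtain a where a: "r = (\<Sum>i<Suc m. a i * \<pi> ^ i)" "\<forall>i<Suc m. a i \<in> T"
    unfolding reps_upto_def by blast
  then have "r = (\<lambda>(s, a). s + a * \<pi> ^ m) ((\<Sum>i<m. a i * \<pi> ^ i), a m)" by simp
  moreover have "((\<Sum>i<m. a i * \<pi> ^ i), a m) \<in> reps_upto \<pi> T m \<times> T"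
    using a by (auto simp: reps_upto_def)
  ultimately show "r \<in> (\<lambda>(s, a). s + a * \<pi> ^ m) ` (reps_upto \<pi> T m \<times> T)" by blast
next
  fix s c assume "s \<in> reps_upto \<pi> T m" "c \<in> T"
  then obtain a where a: "s = (\<Sum>i<m. a i * \<pi> ^ i)" "\<forall>i<m. a i \<in> T" "c \<in> T"
    unfolding reps_upto_def by blast
  then have "s + c * \<pi> ^ m = (\<Sum>i<Suc m. (a(m := c)) i * \<pi> ^ i)"
    by (simp cong: sum.cong_simp)
  moreover have "\<forall>i<Suc m. (a(m := c)) i \<in> T" using a by auto
  ultimately show "s + c * \<pi> ^ m \<in> reps_upto \<pi> T (Suc m)"
    unfolding reps_upto_def by blast
qed

lemma finite_reps_upto: "finite (reps_upto \<pi> T m)"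
  by (induction m) (simp_all add: reps_upto_Suc finite_residue_reps[OF residue_reps])

lemma reps_upto_mono:
  assumes "m \<le> m'"
  shows "reps_upto \<pi> T m \<subseteq> reps_upto \<pi> T m'"
proof (rule lift_Suc_mono_le[OF _ assms])
  fix k
  show "reps_upto \<pi> T k \<subseteq> reps_upto \<pi> T (Suc k)"
    using zero_in_T unfolding reps_upto_Suc by force
qed

lemma zero_in_reps_upto: "0 \<in> reps_upto \<pi> T m"
  using reps_upto_mono[of 0 m] by simp

lemma reps_upto_val_ring: "r \<in> reps_upto \<pi> T m \<Longrightarrow> vabs r \<le> 1"
proof (induction m arbitrary: r)
  case (Suc m)
  then obtain s a where "r = s + a * \<pi> ^ m" "s \<in> reps_upto \<pi> T m" "a \<in> T"
    by (auto simp: reps_upto_Suc)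
  then show ?case
    using Suc.IH T_val_ring[of a] vabs_pi_power_le_1[of m]
    by (auto simp: vabs_times vabs_power intro!: vabs_plus_le mult_le_one)
qed simp

text \<open>Elements close to order m + 1 are close to order m, so their lower parts coincide by
  induction; then the top digits are congruent and hence equal.\<close>

lemma reps_upto_eqI:
  "s \<in> reps_upto \<pi> T m \<Longrightarrow> t \<in> reps_upto \<pi> T m \<Longrightarrow> vabs (s - t) \<le> vabs \<pi> ^ m \<Longrightarrow> s = t"
proof (induction m arbitrary: s t)
  case (Suc m)
  obtain s' a where s: "s = s' + a * \<pi> ^ m" "s' \<in> reps_upto \<pi> T m" "a \<in> T"
    using Suc.prems by (auto simp: reps_upto_Suc)
  obtain t' b where t: "t = t' + b * \<pi> ^ m" "t' \<in> reps_upto \<pi> T m" "b \<in> T"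
    using Suc.prems by (auto simp: reps_upto_Suc)
  have "vabs (b - a) \<le> 1" using s t T_val_ring by (intro vabs_minus_le) auto
  then have "vabs ((b - a) * \<pi> ^ m) \<le> vabs \<pi> ^ m"
    by (simp add: vabs_times vabs_power mult_left_le_one_le)
  moreover have "vabs (s - t) \<le> vabs \<pi> ^ m"
    using Suc.prems(3) vabs_pi_power_mono[of m "Suc m"] by linarith
  \<comment> \<open>The added term removes both top digits and leaves s' - t'.\<close>
  ultimately have "vabs ((s - t) + (b - a) * \<pi> ^ m) \<le> vabs \<pi> ^ m" by (intro vabs_plus_le)
  then have "s' = t'" using s t by (intro Suc.IH) (auto simp: algebra_simps)
  then have "vabs (a - b) * vabs \<pi> ^ m \<le> vabs \<pi> * vabs \<pi> ^ m"
    using Suc.prems(3) s t by (simp add: vabs_times[symmetric] vabs_power[symmetric] left_diff_distrib)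
  then have "vabs (a - b) < 1" using vabs_pi_less_1 by simp
  then show ?case using \<open>s' = t'\<close> s t T_eqI by blast
qed simp

lemma reps_upto_approx:
  assumes "vabs x \<le> 1"
  shows "\<exists>s\<in>reps_upto \<pi> T m. vabs (x - s) \<le> vabs \<pi> ^ m"
proof (induction m)
  case 0
  then show ?case using assms by simp
next
  case (Suc m)
  then obtain s where s: "s \<in> reps_upto \<pi> T m" "vabs (x - s) \<le> vabs \<pi> ^ m" by blast
  \<comment> \<open>The next digit represents the residue class of the rescaled remainder.\<close>
  define y where "y = (x - s) / \<pi> ^ m"
  have "vabs y \<le> 1" using s by (simp add: y_def vabs_divide vabs_power)
  then obtain t where t: "t \<in> T" "vabs (y - t) < 1"
    using residue_reps unfolding residue_reps_def by (metis val_ring_iff max_ideal_iff)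
  have "vabs (y - t) \<le> vabs \<pi>" using t by (intro uniformizer_vabs_le uniformizer)
  moreover have "x - (s + t * \<pi> ^ m) = (y - t) * \<pi> ^ m" by (simp add: y_def field_simps)
  ultimately have "vabs (x - (s + t * \<pi> ^ m)) \<le> vabs \<pi> ^ Suc m"
    by (simp add: vabs_times vabs_power mult_right_mono)
  moreover have "s + t * \<pi> ^ m \<in> reps_upto \<pi> T (Suc m)" using s t by (force simp: reps_upto_Suc)
  ultimately show ?case by blast
qed

text \<open>The truncation of \<open>x\<close> to its first \<open>m\<close> digits. For
  \<open>x\<close> in the valuation ring the choice is unique by \<open>head_eqI\<close>.\<close>

definition head :: "nat \<Rightarrow> 'a \<Rightarrow> 'a" where
  "head m x = (SOME s. s \<in> reps_upto \<pi> T m \<and> vabs (x - s) \<le> vabs \<pi> ^ m)"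

lemma head:
  assumes "vabs x \<le> 1"
  shows "head m x \<in> reps_upto \<pi> T m" "vabs (x - head m x) \<le> vabs \<pi> ^ m"
  unfolding head_def using someI_ex[OF reps_upto_approx[OF assms, of m, unfolded Bex_def]] by auto

lemma head_eqI:
  assumes "vabs x \<le> 1" "s \<in> reps_upto \<pi> T m" "vabs (x - s) \<le> vabs \<pi> ^ m"
  shows "head m x = s"
proof (rule reps_upto_eqI)
  show "vabs (head m x - s) \<le> vabs \<pi> ^ m"
    using head(2)[OF assms(1), of m] assms(3)
    by (metis vabs_diff_trans_le vabs_minus_commute)
qed (rule head(1)[OF assms(1)] assms(2))+

text \<open>The sets \<open>reps_upto\<close> increase with their index, so the least one containing
  \<open>r\<close> decides membership in all of them.\<close>

lemma len_le_iff:
  assumes "r \<in> reps \<pi> T"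
  shows "len \<pi> T r \<le> m \<longleftrightarrow> r \<in> reps_upto \<pi> T m"
proof
  have "r \<in> reps_upto \<pi> T (len \<pi> T r)"
    unfolding len_def using assms by (auto simp: reps_def intro: LeastI)
  then show "len \<pi> T r \<le> m \<Longrightarrow> r \<in> reps_upto \<pi> T m" using reps_upto_mono by blast
  show "r \<in> reps_upto \<pi> T m \<Longrightarrow> len \<pi> T r \<le> m"
    unfolding len_def by (rule Least_le)
qed

lemma reps_vabs_le_1: "r \<in> reps \<pi> T \<Longrightarrow> vabs r \<le> 1"
  by (auto simp: reps_def reps_upto_val_ring)

lemma zero_in_reps: "0 \<in> reps \<pi> T"
  using zero_in_reps_upto by (auto simp: reps_def)

lemma len_0 [simp]: "len \<pi> T 0 = 0"
  using len_le_iff[OF zero_in_reps, of 0] by simp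

lemma gam_0 [simp]: "gam \<pi> T 0 = 1"
  by (simp add: gam_def)

text \<open>The content is uniqueness: a number determines the position of its leading digit, and
  for a given position it determines the remaining digits.\<close>

lemma trunc_eq:
  assumes "s \<in> reps_upto \<pi> T m" "a \<in> T" "a \<noteq> 0"
  shows "trunc \<pi> T (s + a * \<pi> ^ m) = s"
  unfolding trunc_def
proof (rule the_equality)
  obtain c where c: "s = (\<Sum>i<m. c i * \<pi> ^ i)" "\<forall>i<m. c i \<in> T"
    using assms(1) unfolding reps_upto_def by blast
  have "(\<Sum>i<m. (c(m := a)) i * \<pi> ^ i) = s" using c by simp
  moreover have "(\<Sum>i\<le>m. (c(m := a)) i * \<pi> ^ i) = (\<Sum>i<m. (c(m := a)) i * \<pi> ^ i) + a * \<pi> ^ m"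
    by (simp add: lessThan_Suc_atMost[symmetric])
  moreover have "\<forall>i\<le>m. (c(m := a)) i \<in> T" using c assms by auto
  ultimately show "\<exists>b k. (\<forall>i\<le>k. b i \<in> T) \<and> b k \<noteq> 0 \<and>
      s + a * \<pi> ^ m = (\<Sum>i\<le>k. b i * \<pi> ^ i) \<and> s = (\<Sum>i<k. b i * \<pi> ^ i)"
    using assms(3) by (intro exI[of _ "c(m := a)"] exI[of _ m]) simp
next
  fix s' assume "\<exists>b k. (\<forall>i\<le>k. b i \<in> T) \<and> b k \<noteq> 0 \<and>
      s + a * \<pi> ^ m = (\<Sum>i\<le>k. b i * \<pi> ^ i) \<and> s' = (\<Sum>i<k. b i * \<pi> ^ i)"
  then obtain b k where b: "\<forall>i\<le>k. b i \<in> T" "b k \<noteq> 0" "s' = (\<Sum>i<k. b i * \<pi> ^ i)"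
    and eq: "s + a * \<pi> ^ m = s' + b k * \<pi> ^ k"
    by (auto simp: lessThan_Suc_atMost[symmetric])
  have s': "s' \<in> reps_upto \<pi> T k" using b unfolding reps_upto_def by auto
  \<comment> \<open>An expansion ending at position i < j lies in
    \<open>reps_upto \<pi> T j\<close>, as does \<open>v\<close>, and the two differ by at most
    |\<pi>|^j. So they coincide, and the digit \<open>d\<close> would vanish.\<close>
  have False if "i < j" "u \<in> reps_upto \<pi> T i" "v \<in> reps_upto \<pi> T j" "c \<in> T" "d \<in> T" "d \<noteq> 0"
    "u + c * \<pi> ^ i = v + d * \<pi> ^ j" for i j u v c d
  proof -
    have "u + c * \<pi> ^ i \<in> reps_upto \<pi> T (Suc i)" using that by (force simp: reps_upto_Suc)
    then have "u + c * \<pi> ^ i \<in> reps_upto \<pi> T j" using reps_upto_mono[of "Suc i" j] that by auto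
    then have "u + c * \<pi> ^ i = v"
      using that by (intro reps_upto_eqI[of _ j]) (auto simp: vabs_times vabs_power vabs_T)
    then show False using that by simp
  qed
  from this[of m k s s' a "b k"] this[of k m s' s "b k" a] have "m = k"
    using b assms s' eq by (metis le_refl linorder_neqE_nat)
  have "vabs (b k - a) \<le> 1" using b assms T_val_ring by (intro vabs_minus_le) auto
  moreover have "s - s' = (b k - a) * \<pi> ^ m" using eq by (simp add: \<open>m = k\<close> algebra_simps)
  ultimately have "vabs (s - s') \<le> vabs \<pi> ^ m"
    by (simp add: vabs_times vabs_power mult_left_le_one_le)
  then show "s' = s" using reps_upto_eqI[of s m s'] assms s' \<open>m = k\<close> by simp
qed

text \<open>The leading digit sits at position m = \<open>len \<pi> T r\<close> - 1 and is a unit,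
  whence |\<gamma>_r| = |\<pi>|^m. The support of \<chi>_r has the smaller radius |\<pi>|
  |\<gamma>_r|.\<close>

lemma reps_plus_cases:
  assumes "r \<in> reps_plus \<pi> T"
  obtains m where "len \<pi> T r = Suc m" "trunc \<pi> T r \<in> reps_upto \<pi> T m"
    "gam \<pi> T r = r - trunc \<pi> T r" "vabs (gam \<pi> T r) = vabs \<pi> ^ m"
proof -
  have r: "r \<in> reps \<pi> T" "r \<noteq> 0" using assms by (auto simp: reps_plus_def)
  have "len \<pi> T r \<noteq> 0" using len_le_iff[OF r(1), of 0] r by auto
  then obtain m where m: "len \<pi> T r = Suc m" using not0_implies_Suc by blast
  have rm: "r \<in> reps_upto \<pi> T (Suc m)" "r \<notin> reps_upto \<pi> T m"
    using len_le_iff[OF r(1), of m] len_le_iff[OF r(1), of "Suc m"] m by auto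
  then obtain s a where sa: "r = s + a * \<pi> ^ m" "s \<in> reps_upto \<pi> T m" "a \<in> T"
    by (auto simp: reps_upto_Suc)
  then have "a \<noteq> 0" using rm by auto
  then have "trunc \<pi> T r = s" using trunc_eq sa by simp
  then show thesis
    using that[OF m] sa r \<open>a \<noteq> 0\<close> by (simp add: gam_def vabs_times vabs_power vabs_T)
qed

text \<open>The representative of the residue class of 1 is a nonzero digit.\<close>

lemma reps_plus_nonempty: "reps_plus \<pi> T \<noteq> {}"
proof -
  obtain t where t: "t \<in> T" "vabs (1 - t) < 1"
    using residue_reps unfolding residue_reps_def by (metis val_ring_iff max_ideal_iff vabs_1 order_refl)
  then have "t \<noteq> 0" by auto
  moreover have "t \<in> reps_upto \<pi> T (Suc 0)" using t by (force simp: reps_upto_Suc)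
  ultimately show ?thesis by (auto simp: reps_plus_def reps_def)
qed

end

section \<open>Taylor polynomials\<close>

definition swap_le :: "nat \<Rightarrow> ('a::nonarch_field \<Rightarrow> 'a) \<Rightarrow> real \<Rightarrow> real \<Rightarrow> bool" where
  "swap_le m f \<delta> \<epsilon> \<longleftrightarrow>
    (\<forall>S a b. finite S \<and> card S = m \<and> insert a (insert b S) \<subseteq> val_ring \<and> a \<notin> S \<and> b \<notin> S \<and> a \<noteq> b \<and>
       vabs (a - b) \<le> \<delta> \<longrightarrow> vabs (divdiff f (insert a S) - divdiff f (insert b S)) \<le> \<epsilon>)"

definition uniform_swap :: "nat \<Rightarrow> ('a::nonarch_field \<Rightarrow> 'a) \<Rightarrow> bool" where
  "uniform_swap m f \<longleftrightarrow> (\<forall>\<epsilon>>0. \<exists>\<delta>>0. swap_le m f \<delta> \<epsilon>)"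

lemma swap_leD:
  assumes "swap_le m f \<delta> \<epsilon>" "finite S" "card S = m" "S \<subseteq> val_ring" "a \<in> val_ring" "b \<in> val_ring"
    "a \<notin> S" "b \<notin> S" "a \<noteq> b" "vabs (a - b) \<le> \<delta>"
  shows "vabs (divdiff f (insert a S) - divdiff f (insert b S)) \<le> \<epsilon>"
  using assms unfolding swap_le_def by blast

text \<open>One exchange multiplies the nodal polynomial of the \<open>m\<close> shared nodes by at
  most \<epsilon>; its coefficients about \<open>c\<close> are bounded by powers of \<rho>.\<close>

lemma coeff_interp_swap_le:
  assumes "swap_le m f \<delta> \<epsilon>" "finite S" "card S = m" "S \<subseteq> val_ring" "a \<in> val_ring" "b \<in> val_ring"
    "a \<notin> S" "b \<notin> S" "a \<noteq> b" "vabs (a - b) \<le> \<delta>"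
    and "\<And>s. s \<in> S \<Longrightarrow> vabs (c - s) \<le> \<rho>" "0 \<le> \<rho>"
  shows "vabs (poly.coeff (pcompose (interp f (insert a S) - interp f (insert b S)) [:c, 1:]) j) * \<rho> ^ j
    \<le> \<epsilon> * \<rho> ^ m"
proof -
  have "vabs (divdiff f (insert a S) - divdiff f (insert b S)) *
      (vabs (poly.coeff (pcompose (\<Prod>c\<in>S. [:-c, 1:]) [:c, 1:]) j) * \<rho> ^ j) \<le> \<epsilon> * \<rho> ^ m"
    using vabs_coeff_prod_linear[of S c \<rho> j] swap_leD[OF assms(1-10)] assms vabs_nonneg order_trans
    by (intro mult_mono) (auto intro: order_trans[OF vabs_nonneg])
  then show ?thesis
    using assms by (simp add: interp_swap pcompose_smult vabs_times mult.assoc)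
qed

text \<open>Nodes are exchanged one at a time; disjointness of the two node sets keeps every
  intermediate set at m + 1 elements. By the ultrametric inequality all exchanges together cost no
  more than one.\<close>

lemma coeff_interp_chain_le:
  fixes u v :: "nat \<Rightarrow> 'a::nonarch_field"
  assumes "swap_le m f \<delta> \<epsilon>" "0 \<le> \<epsilon>" "0 \<le> \<rho>" "inj_on u {..m}" "inj_on v {..m}"
    "u ` {..m} \<inter> v ` {..m} = {}" "u ` {..m} \<subseteq> val_ring" "v ` {..m} \<subseteq> val_ring"
    and near: "\<And>i. i \<le> m \<Longrightarrow> vabs (u i - v i) \<le> \<delta>"
      "\<And>i. i \<le> m \<Longrightarrow> vabs (c - u i) \<le> \<rho>" "\<And>i. i \<le> m \<Longrightarrow> vabs (c - v i) \<le> \<rho>"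
  shows "vabs (poly.coeff (pcompose (interp f (u ` {..m}) - interp f (v ` {..m})) [:c, 1:]) j) * \<rho> ^ j
    \<le> \<epsilon> * \<rho> ^ m"
proof -
  define h where "h k = v ` {..<k} \<union> u ` {k..m}" for k
  have disj: "u i \<noteq> v j" if "i \<le> m" "j \<le> m" for i j
  proof -
    have "u i \<in> u ` {..m}" "v j \<in> v ` {..m}" using that by auto
    then show ?thesis using assms(6) by (metis disjoint_iff)
  qed
  have "vabs (poly.coeff (pcompose (interp f (u ` {..m}) - interp f (h k)) [:c, 1:]) j) * \<rho> ^ j
      \<le> \<epsilon> * \<rho> ^ m" if "k \<le> Suc m" for k
    using that
  proof (induction k)
    case 0
    have "h 0 = u ` {..m}" by (auto simp: h_def atMost_atLeast0)
    then show ?case using assms by simp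
  next
    case (Suc k)
    define S where "S = v ` {..<k} \<union> u ` {Suc k..m}"
    have k: "k \<le> m" using Suc by simp
    have "{k..m} = insert k {Suc k..m}" using k by auto
    then have hS: "h k = insert (u k) S" "h (Suc k) = insert (v k) S"
      by (auto simp: h_def S_def lessThan_Suc)
    have "v ` {..<k} \<inter> u ` {Suc k..m} = {}" using assms(6) k by fastforce
    then have "card S = card (v ` {..<k}) + card (u ` {Suc k..m})"
      unfolding S_def by (intro card_Un_disjoint) auto
    also have "\<dots> = k + (m - k)"
    proof -
      have "inj_on v {..<k}" "inj_on u {Suc k..m}"
        using k by (auto intro: inj_on_subset[OF assms(5)] inj_on_subset[OF assms(4)])
      then show ?thesis by (simp add: card_image)
    qed
    finally have card: "card S = m" using k by simp
    have uS: "u k \<notin> S"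
    proof
      assume "u k \<in> S"
      then consider i where "i < k" "u k = v i" | i where "k < i" "i \<le> m" "u k = u i"
        unfolding S_def image_iff Un_iff Bex_def lessThan_iff atLeastAtMost_iff Suc_le_eq by blast
      then show False
      proof cases
        case 1
        then show False using disj[of k i] k by auto
      next
        case 2
        then show False using inj_onD[OF assms(4), of k i] k by auto
      qed
    qed
    have vS: "v k \<notin> S"
    proof
      assume "v k \<in> S"
      then consider i where "i < k" "v k = v i" | i where "k < i" "i \<le> m" "v k = u i"
        unfolding S_def image_iff Un_iff Bex_def lessThan_iff atLeastAtMost_iff Suc_le_eq by blast
      then show False
      proof cases
        case 2
        then show False using disj[of i k] k by auto
      next
        case 1
        then show False using inj_onD[OF assms(5), of k i] k by auto
      qed
    qed
    have SR: "S \<subseteq> val_ring" "u k \<in> val_ring" "v k \<in> val_ring"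
      using assms(7,8) k by (auto simp: S_def)
    have Sc: "vabs (c - s) \<le> \<rho>" if "s \<in> S" for s
      using that near k by (auto simp: S_def)
    have step: "vabs (poly.coeff (pcompose (interp f (h k) - interp f (h (Suc k))) [:c, 1:]) j) * \<rho> ^ j
        \<le> \<epsilon> * \<rho> ^ m"
      unfolding hS
      by (rule coeff_interp_swap_le[OF assms(1) _ card SR uS vS disj[OF k k] near(1)[OF k] Sc assms(3)])
        (simp_all add: S_def)
    have split: "poly.coeff (pcompose (interp f (u ` {..m}) - interp f (h (Suc k))) [:c, 1:]) j =
        poly.coeff (pcompose (interp f (u ` {..m}) - interp f (h k)) [:c, 1:]) j +
        poly.coeff (pcompose (interp f (h k) - interp f (h (Suc k))) [:c, 1:]) j" (is "_ = ?x + ?y")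
      by (simp add: pcompose_diff)
    have "vabs (?x + ?y) * \<rho> ^ j \<le> max (vabs ?x) (vabs ?y) * \<rho> ^ j"
      using assms(3) by (intro mult_right_mono vabs_plus_le_max) auto
    also have "\<dots> \<le> \<epsilon> * \<rho> ^ m"
      using Suc.IH Suc.prems step by (metis Suc_leD max_def)
    finally show ?case unfolding split .
  qed
  from this[of "Suc m"] show ?thesis by (simp add: h_def lessThan_Suc_atMost)
qed

lemma divdiff_chain_le:
  fixes u v :: "nat \<Rightarrow> 'a::nonarch_field"
  assumes "swap_le m f \<delta> \<epsilon>" "0 \<le> \<epsilon>" "inj_on u {..m}" "inj_on v {..m}"
    "u ` {..m} \<inter> v ` {..m} = {}" "u ` {..m} \<subseteq> val_ring" "v ` {..m} \<subseteq> val_ring"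
    and "\<And>i. i \<le> m \<Longrightarrow> vabs (u i - v i) \<le> \<delta>"
  shows "vabs (divdiff f (u ` {..m}) - divdiff f (v ` {..m})) \<le> \<epsilon>"
proof -
  \<comment> \<open>Substituting \<open>[:0, 1:]\<close> changes nothing, and the coefficient of
    index \<open>m\<close> is the divided difference. Radius 1 suits nodes in the valuation
    ring.\<close>
  have "vabs (poly.coeff (pcompose (interp f (u ` {..m}) - interp f (v ` {..m})) [:0, 1:]) m) * 1 ^ m \<le> \<epsilon> * 1 ^ m"
    using assms by (intro coeff_interp_chain_le[where \<delta> = \<delta>]) (auto simp: val_ring_iff)
  then show ?thesis using assms by (simp add: coeff_interp card_image)
qed

context digit_system
begin

text \<open>Distinct points tending to \<open>r\<close> as \<open>t\<close> grows, chosen so that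
  passing from \<open>t\<close> to t + 1 exchanges a single node, \<open>r + \<pi> ^ t\<close> for
  \<open>r + \<pi> ^ (t + Suc m)\<close>.\<close>

definition nodes :: "nat \<Rightarrow> 'a \<Rightarrow> nat \<Rightarrow> 'a set" where
  "nodes m r t = (\<lambda>i. r + \<pi> ^ (t + i)) ` {..m}"

lemma pi_power_eq_iff [simp]: "\<pi> ^ i = \<pi> ^ j \<longleftrightarrow> i = j"
proof
  assume "\<pi> ^ i = \<pi> ^ j"
  then have "vabs \<pi> ^ i = vabs \<pi> ^ j" by (simp flip: vabs_power)
  then show "i = j"
    using vabs_pi_power_strict_mono[of i j] vabs_pi_power_strict_mono[of j i] by (metis less_irrefl linorder_neqE_nat)
qed simp

lemma inj_nodes: "inj_on (\<lambda>i. r + \<pi> ^ (t + i)) A"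
  by (rule inj_onI) simp

lemma finite_nodes: "finite (nodes m r t)" and card_nodes: "card (nodes m r t) = Suc m"
  by (simp_all add: nodes_def card_image inj_nodes)

lemma node_val_ring: "vabs r \<le> 1 \<Longrightarrow> vabs (r + \<pi> ^ k) \<le> 1"
  by (intro vabs_plus_le) (simp_all add: vabs_power vabs_pi_power_le_1)

lemma vabs_pi_power_diff: "vabs (\<pi> ^ i - \<pi> ^ j) \<le> vabs \<pi> ^ min i j"
  by (intro vabs_minus_le) (simp_all add: vabs_power vabs_pi_power_mono)

lemma degree_interp_nodes: "degree (interp f (nodes m r t)) \<le> m"
  using degree_interp[OF finite_nodes, of f m r t] by (simp add: card_nodes)

lemma eventually_pi_power_less:
  assumes "(\<delta>::real) > 0"
  shows "\<forall>\<^sub>F t in sequentially. vabs \<pi> ^ t < \<delta>"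
  using order_tendstoD(2)[OF vabs_pi_power_tendsto_0 assms] .

text \<open>Consecutive node sets differ by one exchange over a distance at most |\<pi>|^t, so the
  steps of each coefficient tend to 0.\<close>

lemma coeff_interp_nodes_convergent:
  assumes "uniform_swap m f" "vabs r \<le> 1"
  shows "convergent (\<lambda>t. poly.coeff (interp f (nodes m r t)) j)"
proof (rule convergent_if_steps_tendsto_0)
  show "(\<lambda>t. poly.coeff (interp f (nodes m r (Suc t))) j - poly.coeff (interp f (nodes m r t)) j) \<longlonglongrightarrow> 0"
    unfolding tendsto_iff
  proof (intro allI impI)
    fix e :: real assume "e > 0"
    then obtain \<delta> where \<delta>: "\<delta> > 0" "swap_le m f \<delta> (e / 2)"
      using assms(1) unfolding uniform_swap_def by (meson half_gt_zero)
    show "\<forall>\<^sub>F t in sequentially. dist (poly.coeff (interp f (nodes m r (Suc t))) j - poly.coeff (interp f (nodes m r t)) j) 0 < e"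
      using eventually_pi_power_less[OF \<delta>(1)]
    proof eventually_elim
      case (elim t)
      define S where "S = (\<lambda>i. r + \<pi> ^ (t + i)) ` {Suc 0..m}"
      have at: "{..m} = insert 0 {Suc 0..m}" by auto
      then have 1: "nodes m r t = insert (r + \<pi> ^ t) S"
        by (simp only: nodes_def S_def at image_insert add_0_right)
      have "nodes m r (Suc t) = (\<lambda>i. r + \<pi> ^ (t + i)) ` Suc ` {..m}"
        unfolding nodes_def image_image by simp
      also have "Suc ` {..m} = insert (Suc m) {Suc 0..m}"
        by (auto simp: image_Suc_atMost)
      finally have 2: "nodes m r (Suc t) = insert (r + \<pi> ^ (t + Suc m)) S"
        unfolding S_def by simp
      have "vabs (poly.coeff (pcompose (interp f (insert (r + \<pi> ^ (t + Suc m)) S) -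
          interp f (insert (r + \<pi> ^ t) S)) [:0, 1:]) j) * 1 ^ j \<le> e / 2 * 1 ^ m"
      proof (rule coeff_interp_swap_le[OF \<delta>(2)])
        show "card S = m" unfolding S_def by (subst card_image) (auto simp: inj_nodes)
        have "vabs (\<pi> ^ (t + Suc m) - \<pi> ^ t) \<le> vabs \<pi> ^ t"
          using vabs_pi_power_diff[of "t + Suc m" t] by (simp add: min_def)
        then show "vabs (r + \<pi> ^ (t + Suc m) - (r + \<pi> ^ t)) \<le> \<delta>"
          using elim by simp
        show "vabs (0 - s) \<le> 1" if "s \<in> S" for s
          using that assms(2) by (auto simp: S_def node_val_ring)
      qed (use assms(2) in \<open>auto simp: S_def val_ring_iff node_val_ring simp del: power_Suc\<close>)
      then show ?case using \<open>e > 0\<close> by (simp add: 1 2 dist_eq_vabs)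
    qed
  qed
qed

text \<open>For points of the valuation ring \<open>uniform_swap\<close> ensures that the limit
  exists; limits of coefficients being unique, the choice is then determined.\<close>

definition taylor :: "nat \<Rightarrow> ('a \<Rightarrow> 'a) \<Rightarrow> 'a \<Rightarrow> 'a poly" where
  "taylor m f r = (SOME p. coeffwise_lim (\<lambda>t. interp f (nodes m r t)) p \<and> degree p \<le> m)"

lemma taylor:
  assumes "uniform_swap m f" "vabs r \<le> 1"
  shows "coeffwise_lim (\<lambda>t. interp f (nodes m r t)) (taylor m f r)" "degree (taylor m f r) \<le> m"
  using someI_ex[OF coeffwise_lim_exists[OF degree_interp_nodes coeff_interp_nodes_convergent[OF assms]]]
  unfolding taylor_def by auto

text \<open>Once |\<pi>|^t < |r - s|, the nodes at \<open>r\<close> and at \<open>s\<close> are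
  disjoint and the exchange estimate applies with centre \<open>r\<close> and both radii |r - s|.
  Then \<open>t\<close> tends to infinity.\<close>

lemma coeff_taylor_diff_le:
  assumes "uniform_swap m f" "vabs r \<le> 1" "vabs s \<le> 1" "r \<noteq> s"
    and "swap_le m f (vabs (r - s)) \<epsilon>" "0 \<le> \<epsilon>"
  shows "vabs (poly.coeff (pcompose (taylor m f r - taylor m f s) [:r, 1:]) j) * vabs (r - s) ^ j
    \<le> \<epsilon> * vabs (r - s) ^ m"
proof (rule tendsto_upperbound[OF _ _ sequentially_bot])
  let ?D = "\<lambda>t. interp f (nodes m r t) - interp f (nodes m s t)"
  have "coeffwise_lim (\<lambda>t. pcompose (?D t) [:r, 1:]) (pcompose (taylor m f r - taylor m f s) [:r, 1:])"
    using assms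
    by (intro coeffwise_lim_pcompose[where d = m] coeffwise_lim_diff taylor degree_diff_le degree_interp_nodes)
  then have "(\<lambda>t. poly.coeff (pcompose (?D t) [:r, 1:]) j)
      \<longlonglongrightarrow> poly.coeff (pcompose (taylor m f r - taylor m f s) [:r, 1:]) j"
    by (simp add: coeffwise_lim_def)
  from tendsto_vabs[OF this]
  show "(\<lambda>t. vabs (poly.coeff (pcompose (?D t) [:r, 1:]) j) * vabs (r - s) ^ j)
      \<longlonglongrightarrow> vabs (poly.coeff (pcompose (taylor m f r - taylor m f s) [:r, 1:]) j) * vabs (r - s) ^ j"
    by (intro tendsto_mult_right)
  have "0 < vabs (r - s)" using assms by simp
  from eventually_pi_power_less[OF this]
  show "\<forall>\<^sub>F t in sequentially. vabs (poly.coeff (pcompose (?D t) [:r, 1:]) j) * vabs (r - s) ^ j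
      \<le> \<epsilon> * vabs (r - s) ^ m"
  proof eventually_elim
    case (elim t)
    have small: "vabs (\<pi> ^ (t + i)) < vabs (r - s)" for i
      using elim vabs_pi_power_mono[of t "t + i"] unfolding vabs_power by linarith
    show ?case
      unfolding nodes_def
    proof (rule coeff_interp_chain_le[OF assms(5,6)])
      show "(\<lambda>i. r + \<pi> ^ (t + i)) ` {..m} \<inter> (\<lambda>i. s + \<pi> ^ (t + i)) ` {..m} = {}"
      proof (rule ccontr)
        assume "\<not> ?thesis"
        then obtain i j where "r + \<pi> ^ (t + i) = s + \<pi> ^ (t + j)" by blast
        then have "r - s = \<pi> ^ (t + j) - \<pi> ^ (t + i)" by (simp add: algebra_simps)
        then have "vabs (r - s) \<le> max (vabs (\<pi> ^ (t + j))) (vabs (\<pi> ^ (t + i)))"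
          using vabs_minus_le by (metis max.cobounded1 max.cobounded2)
        then show False using small[of i] small[of j] by linarith
      qed
      show "vabs (r - (s + \<pi> ^ (t + i))) \<le> vabs (r - s)" for i
        using vabs_minus_le[of "r - s" "vabs (r - s)" "\<pi> ^ (t + i)"] small[of i] by (simp add: algebra_simps)
      show "vabs (r - (r + \<pi> ^ (t + i))) \<le> vabs (r - s)" for i
        using small[of i] by simp
    qed (use assms in \<open>auto simp: val_ring_iff node_val_ring intro: inj_nodes\<close>)
  qed
qed

text \<open>Replacing the node \<open>s + \<pi> ^ t\<close> by \<open>x\<close> changes the value of
  the interpolation polynomial at \<open>x\<close> by at most \<epsilon>, and the new polynomial
  takes the value f(x) there. Then \<open>t\<close> tends to infinity.\<close>

lemma taylor_approx:
  assumes "uniform_swap m f" "vabs x \<le> 1" "vabs s \<le> 1" "swap_le m f \<delta> \<epsilon>" "0 \<le> \<epsilon>" "0 < \<delta>" "vabs (x - s) \<le> \<delta>"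
  shows "vabs (f x - poly (taylor m f s) x) \<le> \<epsilon>"
proof (rule tendsto_upperbound[OF _ _ sequentially_bot])
  have "(\<lambda>t. poly (interp f (nodes m s t)) x) \<longlonglongrightarrow> poly (taylor m f s) x"
    by (rule coeffwise_lim_poly[OF taylor(1) degree_interp_nodes taylor(2)]) (fact assms)+
  then show "(\<lambda>t. vabs (f x - poly (interp f (nodes m s t)) x)) \<longlonglongrightarrow> vabs (f x - poly (taylor m f s) x)"
    by (intro tendsto_vabs tendsto_diff tendsto_const)
  have "\<forall>\<^sub>F t in sequentially. x = s \<or> vabs \<pi> ^ t < vabs (x - s)"
    using eventually_pi_power_less[of "vabs (x - s)"] by (cases "x = s") auto
  then show "\<forall>\<^sub>F t in sequentially. vabs (f x - poly (interp f (nodes m s t)) x) \<le> \<epsilon>"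
    using eventually_pi_power_less[OF assms(6)]
  proof eventually_elim
    case (elim t)
    \<comment> \<open>If x = s, the point is never a node; otherwise it is none once |\<pi>|^t < |x
      - s|.\<close>
    have ne: "x \<noteq> s + \<pi> ^ (t + i)" for i
    proof
      assume x: "x = s + \<pi> ^ (t + i)"
      then have "vabs \<pi> ^ t < vabs (x - s)" using elim by auto
      then show False using x vabs_pi_power_mono[of t "t + i"] by (simp add: vabs_power)
    qed
    define S where "S = (\<lambda>i. s + \<pi> ^ (t + i)) ` {Suc 0..m}"
    have at: "{..m} = insert 0 {Suc 0..m}" by auto
    then have nodes: "nodes m s t = insert (s + \<pi> ^ t) S"
      by (simp only: nodes_def S_def at image_insert add_0_right)
    have S: "finite S" "x \<notin> S" "s + \<pi> ^ t \<notin> S" "S \<subseteq> val_ring"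
      using ne assms(3) by (auto simp: S_def val_ring_iff node_val_ring)
    have "vabs (divdiff f (insert x S) - divdiff f (insert (s + \<pi> ^ t) S)) \<le> \<epsilon>"
    proof (rule swap_leD[OF assms(4) S(1) _ S(4) _ _ S(2,3)])
      show "card S = m" unfolding S_def by (subst card_image) (auto simp: inj_nodes)
      show "x \<noteq> s + \<pi> ^ t" using ne[of 0] by simp
      have "vabs ((x - s) - \<pi> ^ t) \<le> \<delta>" using assms elim by (intro vabs_minus_le[of "x - s"]) (simp_all add: vabs_power)
      then show "vabs (x - (s + \<pi> ^ t)) \<le> \<delta>" by (simp add: algebra_simps)
    qed (use assms in \<open>auto simp: val_ring_iff node_val_ring\<close>)
    moreover have "vabs (\<Prod>c\<in>S. x - c) \<le> 1"
      unfolding vabs_prod using S(4) assms(2)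
      by (intro prod_le_1) (auto simp: val_ring_iff intro!: vabs_minus_le)
    ultimately have "vabs ((divdiff f (insert x S) - divdiff f (insert (s + \<pi> ^ t) S)) * (\<Prod>c\<in>S. x - c)) \<le> \<epsilon> * 1"
      unfolding vabs_times using assms(5) by (intro mult_mono) auto
    moreover have "f x - poly (interp f (nodes m s t)) x =
        poly (interp f (insert x S) - interp f (insert (s + \<pi> ^ t) S)) x"
      using S(1) by (simp add: nodes poly_interp)
    ultimately show ?case using S by (simp add: interp_swap poly_prod)
  qed
qed

end

section \<open>Existence and uniqueness of the expansion\<close>

context digit_system
begin

section \<open>Absolute values of \<gamma>_r and of the wavelets\<close>

lemma reps_cases:
  assumes "r \<in> reps \<pi> T"
  obtains "r = 0" | "r \<in> reps_plus \<pi> T"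
  using assms by (auto simp: reps_plus_def)

lemma gam_nonzero:
  assumes "r \<in> reps \<pi> T"
  shows "gam \<pi> T r \<noteq> 0"
  using assms
proof (cases rule: reps_cases)
  case 2
  then obtain k where "vabs (gam \<pi> T r) = vabs \<pi> ^ k" by (rule reps_plus_cases)
  then show ?thesis by (metis pi_nonzero power_eq_0_iff vabs_eq_0_iff)
qed simp

lemma vabs_gam_le_1:
  assumes "r \<in> reps \<pi> T"
  shows "vabs (gam \<pi> T r) \<le> 1"
  using assms
proof (cases rule: reps_cases)
  case 2
  then obtain k where "vabs (gam \<pi> T r) = vabs \<pi> ^ k" by (rule reps_plus_cases)
  then show ?thesis by (simp add: vabs_pi_power_le_1)
qed simp

lemma vabs_pi_power_len_le_gam:
  assumes "r \<in> reps \<pi> T"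
  shows "vabs \<pi> ^ len \<pi> T r \<le> vabs (gam \<pi> T r)"
  using assms
proof (cases rule: reps_cases)
  case 2
  then obtain k where "len \<pi> T r = Suc k" "vabs (gam \<pi> T r) = vabs \<pi> ^ k" by (rule reps_plus_cases)
  then show ?thesis using vabs_pi_power_mono[of k "Suc k"] by simp
qed simp

lemma vabs_gam_le_pi_power:
  assumes "r \<in> reps \<pi> T" "k < len \<pi> T r"
  shows "vabs (gam \<pi> T r) \<le> vabs \<pi> ^ k"
  using assms(1)
proof (cases rule: reps_cases)
  case 2
  then obtain i where "len \<pi> T r = Suc i" "vabs (gam \<pi> T r) = vabs \<pi> ^ i" by (rule reps_plus_cases)
  then show ?thesis using assms(2) vabs_pi_power_mono[of k i] by simp
qed (use assms in simp)

text \<open>On the support |x - r| \<le> |\<gamma>_r|, so the two exponents combine to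
  \<open>m\<close>.\<close>

lemma vabs_wavelet_le:
  assumes "r \<in> reps \<pi> T" "j \<le> m"
  shows "vabs (wavelet \<pi> T m r j x) \<le> vabs (gam \<pi> T r) ^ m"
proof (cases "vabs (x - r) \<le> vabs \<pi> ^ len \<pi> T r")
  case True
  then have "vabs (x - r) \<le> vabs (gam \<pi> T r)"
    using vabs_pi_power_len_le_gam[OF assms(1)] by linarith
  then have "vabs (gam \<pi> T r) ^ (m - j) * vabs (x - r) ^ j \<le> vabs (gam \<pi> T r) ^ (m - j) * vabs (gam \<pi> T r) ^ j"
    by (intro mult_left_mono power_mono) auto
  also have "\<dots> = vabs (gam \<pi> T r) ^ m" using assms(2) by (simp flip: power_add)
  finally show ?thesis using True by (simp add: wavelet_def chi_eq vabs_times vabs_power)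
qed (simp add: wavelet_def chi_eq)

section \<open>Wavelet coefficients from Taylor polynomials\<close>

lemma poly_shift_eq:
  fixes p :: "'a poly"
  assumes "degree p \<le> m"
  shows "poly p x = (\<Sum>j=0..m. poly.coeff (pcompose p [:r, 1:]) j * (x - r) ^ j)"
proof -
  have "degree (pcompose p [:r, 1:]) \<le> m" using degree_pcompose[of p "[:r, 1:]"] assms by simp
  then have "poly (pcompose p [:r, 1:]) (x - r) = (\<Sum>j\<le>m. poly.coeff (pcompose p [:r, 1:]) j * (x - r) ^ j)"
    unfolding poly_altdef by (intro sum.mono_neutral_left) (auto simp: coeff_eq_0)
  then show ?thesis by (simp add: poly_pcompose atMost_atLeast0)
qed

text \<open>The division by a power of \<gamma>_r undoes the scaling in the wavelet. The index 0 has
  no predecessor and carries the Taylor polynomial at 0 itself. The value 0 outside the index set is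
  what \<open>is_expansion\<close> demands.\<close>

definition wcoeff :: "nat \<Rightarrow> ('a \<Rightarrow> 'a) \<Rightarrow> 'a \<Rightarrow> nat \<Rightarrow> 'a" where
  "wcoeff m f r j =
    (if r \<notin> reps \<pi> T \<or> j > m then 0
     else if r = 0 then poly.coeff (taylor m f 0) j
     else poly.coeff (pcompose (taylor m f r - taylor m f (trunc \<pi> T r)) [:r, 1:]) j / gam \<pi> T r ^ (m - j))"

text \<open>With s = r_- one has |r - s| = |\<gamma>_r|, and the powers of |\<gamma>_r| in the
  Taylor estimate cancel against the normalisation.\<close>

lemma wcoeff_le:
  assumes "uniform_swap m f" "r \<in> reps_plus \<pi> T" "swap_le m f (vabs (gam \<pi> T r)) \<epsilon>" "0 \<le> \<epsilon>"
  shows "vabs (wcoeff m f r j) \<le> \<epsilon>"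
proof (cases "j \<le> m")
  case True
  have r: "r \<in> reps \<pi> T" "r \<noteq> 0" using assms(2) by (auto simp: reps_plus_def)
  define g where "g = vabs (gam \<pi> T r)"
  define s where "s = trunc \<pi> T r"
  obtain k where k: "s \<in> reps_upto \<pi> T k" "gam \<pi> T r = r - s"
    using assms(2) unfolding s_def by (rule reps_plus_cases)
  have pos: "0 < g" using gam_nonzero[OF r(1)] by (simp add: g_def)
  have "vabs (poly.coeff (pcompose (taylor m f r - taylor m f s) [:r, 1:]) j) * g ^ j \<le> \<epsilon> * g ^ m"
    using assms gam_nonzero[OF r(1)] reps_vabs_le_1[OF r(1)] reps_upto_val_ring[OF k(1)]
    unfolding g_def k(2) by (intro coeff_taylor_diff_le) auto
  moreover have "poly.coeff (pcompose (taylor m f r - taylor m f s) [:r, 1:]) j =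
      wcoeff m f r j * gam \<pi> T r ^ (m - j)"
    using r True gam_nonzero[OF r(1)] by (simp add: wcoeff_def s_def)
  ultimately have "vabs (wcoeff m f r j) * (g ^ (m - j) * g ^ j) \<le> \<epsilon> * g ^ m"
    by (simp add: vabs_times vabs_power g_def mult.assoc)
  then show ?thesis using True pos by (simp flip: power_add)
qed (use assms in \<open>simp add: wcoeff_def\<close>)

lemma sum_wcoeff_wavelet:
  assumes "uniform_swap m f" "r \<in> reps_plus \<pi> T"
  shows "(\<Sum>j=0..m. wcoeff m f r j * wavelet \<pi> T m r j x) =
    chi \<pi> T r x * poly (taylor m f r - taylor m f (trunc \<pi> T r)) x"
proof -
  have r: "r \<in> reps \<pi> T" "r \<noteq> 0" using assms(2) by (auto simp: reps_plus_def)
  obtain k where k: "trunc \<pi> T r \<in> reps_upto \<pi> T k"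
    using assms(2) by (rule reps_plus_cases)
  have "degree (taylor m f r - taylor m f (trunc \<pi> T r)) \<le> m"
    using taylor(2)[OF assms(1)] reps_vabs_le_1[OF r(1)] reps_upto_val_ring[OF k]
    by (intro degree_diff_le) auto
  then have "poly (taylor m f r - taylor m f (trunc \<pi> T r)) x =
      (\<Sum>j=0..m. poly.coeff (pcompose (taylor m f r - taylor m f (trunc \<pi> T r)) [:r, 1:]) j * (x - r) ^ j)"
    by (rule poly_shift_eq)
  then show ?thesis
    using r gam_nonzero[OF r(1)]
    by (auto simp: sum_distrib_left wcoeff_def wavelet_def intro!: sum.cong)
qed

text \<open>Telescoping along the truncations of \<open>x\<close>: a new nonzero digit adds the
  Taylor polynomial at the longer truncation and removes that at the shorter one; a zero digit adds
  nothing.\<close>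

lemma partial_sum_eq_taylor:
  assumes "uniform_swap m f" "vabs x \<le> 1"
  shows "(\<Sum>r\<in>reps_upto \<pi> T L. \<Sum>j=0..m. wcoeff m f r j * wavelet \<pi> T m r j x) =
    poly (taylor m f (head L x)) x"
proof (induction L)
  case 0
  have "head 0 x = 0" using head(1)[OF assms(2), of 0] by simp
  moreover have "poly (taylor m f 0) x = (\<Sum>j=0..m. poly.coeff (taylor m f 0) j * x ^ j)"
    using poly_shift_eq[OF taylor(2)[OF assms(1)], of 0 x 0] by simp
  ultimately show ?case
    using assms(2) zero_in_reps by (simp add: wcoeff_def wavelet_def chi_eq)
next
  case (Suc L)
  define N where "N = reps_upto \<pi> T (Suc L) - reps_upto \<pi> T L"
  define h where "h = head (Suc L) x"
  have h: "h \<in> reps_upto \<pi> T (Suc L)" "vabs (x - h) \<le> vabs \<pi> ^ Suc L"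
    using head[OF assms(2)] unfolding h_def by blast+
  have Nplus: "r \<in> reps_plus \<pi> T" and Nlen: "len \<pi> T r = Suc L" if "r \<in> N" for r
  proof -
    have r: "r \<in> reps \<pi> T" using that by (auto simp: N_def reps_def)
    show "len \<pi> T r = Suc L"
      using len_le_iff[OF r, of L] len_le_iff[OF r, of "Suc L"] that by (auto simp: N_def)
    show "r \<in> reps_plus \<pi> T"
      using r that zero_in_reps_upto[of L] by (auto simp: N_def reps_plus_def)
  qed
  \<comment> \<open>Distinct elements of \<open>reps_upto \<pi> T (Suc L)\<close> have disjoint
    balls, so only \<open>h\<close> can contribute.\<close>
  have chiN: "chi \<pi> T r x = (if r = h then 1 else 0)" if "r \<in> N" for r
  proof -
    have "vabs (x - r) \<le> vabs \<pi> ^ Suc L \<longleftrightarrow> r = h"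
      using head_eqI[OF assms(2), of r "Suc L"] h that unfolding h_def N_def by blast
    then show ?thesis using that by (simp add: chi_eq Nlen)
  qed
  have U: "reps_upto \<pi> T (Suc L) = reps_upto \<pi> T L \<union> N" "reps_upto \<pi> T L \<inter> N = {}" "finite N"
    using reps_upto_mono[of L "Suc L"] finite_reps_upto by (auto simp: N_def)
  have sumN: "(\<Sum>r\<in>N. \<Sum>j=0..m. wcoeff m f r j * wavelet \<pi> T m r j x) =
      (if h \<in> N then poly (taylor m f h - taylor m f (trunc \<pi> T h)) x else 0)"
  proof -
    have "(\<Sum>r\<in>N. \<Sum>j=0..m. wcoeff m f r j * wavelet \<pi> T m r j x) =
        (\<Sum>r\<in>N. if r = h then poly (taylor m f h - taylor m f (trunc \<pi> T h)) x else 0)"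
      by (intro sum.cong refl) (simp add: sum_wcoeff_wavelet[OF assms(1) Nplus] chiN)
    then show ?thesis using U(3) by (simp add: sum.delta)
  qed
  \<comment> \<open>Membership of \<open>h\<close> in \<open>N\<close> means that the digit of
    \<open>x\<close> at position \<open>L\<close> is nonzero.\<close>
  have "head L x = (if h \<in> N then trunc \<pi> T h else h)"
  proof (cases "h \<in> N")
    case True
    obtain k where k: "len \<pi> T h = Suc k" "trunc \<pi> T h \<in> reps_upto \<pi> T k"
      "gam \<pi> T h = h - trunc \<pi> T h" "vabs (gam \<pi> T h) = vabs \<pi> ^ k"
      using Nplus[OF True] by (rule reps_plus_cases)
    have "k = L" using k Nlen[OF True] by simp
    moreover have "vabs (x - h) \<le> vabs \<pi> ^ L" using h(2) vabs_pi_power_mono[of L "Suc L"] by linarith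
    moreover have "vabs (h - trunc \<pi> T h) \<le> vabs \<pi> ^ L"
      unfolding k(3)[symmetric] k(4) \<open>k = L\<close> by simp
    ultimately have "head L x = trunc \<pi> T h"
      using k(2) by (intro head_eqI[OF assms(2)]) (auto intro: vabs_diff_trans_le)
    then show ?thesis using True by simp
  next
    case False
    then have "h \<in> reps_upto \<pi> T L" using h(1) by (auto simp: N_def)
    moreover have "vabs (x - h) \<le> vabs \<pi> ^ L" using h(2) vabs_pi_power_mono[of L "Suc L"] by linarith
    ultimately have "head L x = h" by (rule head_eqI[OF assms(2)])
    then show ?thesis using False by simp
  qed
  then show ?case
    using U finite_reps_upto[of L] Suc.IH
    by (simp add: U(1) sum.union_disjoint sumN h_def[symmetric])
qed

section \<open>Existence of the expansion\<close>

lemma swap_le_mono: "swap_le m f \<delta> \<epsilon> \<Longrightarrow> \<delta>' \<le> \<delta> \<Longrightarrow> swap_le m f \<delta>' \<epsilon>"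
  unfolding swap_le_def[of m f \<delta>'] by (intro allI impI swap_leD[of m f \<delta> \<epsilon>]) auto

text \<open>A single \<open>k\<close> serves twice: truncation at length \<open>k\<close> is fine
  enough for the Taylor approximation, and all coefficients beyond that length are small.\<close>

lemma wcoeff_small:
  assumes "uniform_swap m f" "0 < \<epsilon>"
  shows "\<exists>k \<delta>. 0 < \<delta> \<and> vabs \<pi> ^ k \<le> \<delta> \<and> swap_le m f \<delta> \<epsilon> \<and>
    (\<forall>r\<in>reps \<pi> T - reps_upto \<pi> T k. \<forall>j. vabs (wcoeff m f r j) \<le> \<epsilon>)"
proof -
  obtain \<delta> where \<delta>: "\<delta> > 0" "swap_le m f \<delta> \<epsilon>"
    using assms unfolding uniform_swap_def by blast
  obtain k where k: "vabs \<pi> ^ k < \<delta>" using vabs_pi_power_less[OF \<delta>(1)] .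
  have "vabs (wcoeff m f r j) \<le> \<epsilon>" if r: "r \<in> reps \<pi> T - reps_upto \<pi> T k" for r j
  proof (rule wcoeff_le[OF assms(1)])
    show "r \<in> reps_plus \<pi> T" using r zero_in_reps_upto by (auto simp: reps_plus_def)
    have "vabs (gam \<pi> T r) \<le> vabs \<pi> ^ k"
      using r len_le_iff[of r k] by (intro vabs_gam_le_pi_power) auto
    then show "swap_le m f (vabs (gam \<pi> T r)) \<epsilon>"
      using k by (intro swap_le_mono[OF \<delta>(2)]) auto
  qed (use assms in simp)
  then show ?thesis using \<delta> k by (intro exI[of _ k] exI[of _ \<delta>]) auto
qed

text \<open>Over the finitely many indices of length at most \<open>k\<close> the partial sum is a
  Taylor polynomial close to f(x); by the ultrametric inequality any further small terms preserve
  the estimate. Finiteness of \<open>reps_upto\<close> gives the decay of the coefficients.\<close>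

lemma is_expansion_wcoeff:
  assumes "uniform_swap m f"
  shows "is_expansion \<pi> T m f (wcoeff m f)"
  unfolding is_expansion_def
proof (intro conjI)
  show "\<forall>r j. (r, j) \<notin> reps \<pi> T \<times> {0..m} \<longrightarrow> wcoeff m f r j = 0"
    by (auto simp: wcoeff_def)
  show "((\<lambda>(r, j). wcoeff m f r j) \<longlongrightarrow> 0) cofinite"
    unfolding tendsto_iff
  proof (intro allI impI)
    fix e :: real assume "e > 0"
    then obtain k where k: "\<forall>r\<in>reps \<pi> T - reps_upto \<pi> T k. \<forall>j. vabs (wcoeff m f r j) \<le> e / 2"
      using wcoeff_small[OF assms, of "e / 2"] by auto
    have "{x. \<not> dist (case x of (r, j) \<Rightarrow> wcoeff m f r j) 0 < e} \<subseteq> reps_upto \<pi> T k \<times> {0..m}"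
    proof (rule subsetI, rule ccontr)
      fix z assume z: "z \<in> {x. \<not> dist (case x of (r, j) \<Rightarrow> wcoeff m f r j) 0 < e}"
        "z \<notin> reps_upto \<pi> T k \<times> {0..m}"
      obtain r j where "z = (r, j)" by (cases z)
      with z have *: "\<not> dist (wcoeff m f r j) 0 < e" "(r, j) \<notin> reps_upto \<pi> T k \<times> {0..m}" by auto
      have "vabs (wcoeff m f r j) \<le> e / 2"
      proof (cases "r \<in> reps \<pi> T \<and> j \<le> m")
        case True
        then show ?thesis using k *(2) by auto
      qed (use \<open>e > 0\<close> in \<open>auto simp: wcoeff_def\<close>)
      then show False using * \<open>e > 0\<close> by (simp add: dist_eq_vabs)
    qed
    then have "finite {x. \<not> dist (case x of (r, j) \<Rightarrow> wcoeff m f r j) 0 < e}"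
      by (rule finite_subset) (simp add: finite_reps_upto)
    then show "\<forall>\<^sub>F x in cofinite. dist (case x of (r, j) \<Rightarrow> wcoeff m f r j) 0 < e"
      by (simp add: eventually_cofinite)
  qed
  show "\<forall>x\<in>val_ring. ((\<lambda>(r, j). wcoeff m f r j * wavelet \<pi> T m r j x) has_sum f x) (reps \<pi> T \<times> {0..m})"
  proof
    fix x :: 'a assume "x \<in> val_ring"
    then have x: "vabs x \<le> 1" by (simp add: val_ring_iff)
    define w where "w = (\<lambda>(r, j). wcoeff m f r j * wavelet \<pi> T m r j x)"
    have "(w has_sum f x) (reps \<pi> T \<times> {0..m})"
      unfolding has_sum_def tendsto_iff
    proof (intro allI impI)
      fix e :: real assume e: "e > 0"
      obtain k \<delta> where k: "0 < \<delta>" "vabs \<pi> ^ k \<le> \<delta>" "swap_le m f \<delta> (e / 2)"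
        "\<forall>r\<in>reps \<pi> T - reps_upto \<pi> T k. \<forall>j. vabs (wcoeff m f r j) \<le> e / 2"
        using wcoeff_small[OF assms, of "e / 2"] e by auto
      define F0 where "F0 = reps_upto \<pi> T k \<times> {0..m}"
      have F0: "finite F0" "F0 \<subseteq> reps \<pi> T \<times> {0..m}"
        by (auto simp: F0_def finite_reps_upto reps_def)
      have "sum w F0 = poly (taylor m f (head k x)) x"
        unfolding F0_def w_def by (simp add: partial_sum_eq_taylor[OF assms x] flip: sum.cartesian_product)
      moreover have "vabs (f x - poly (taylor m f (head k x)) x) \<le> e / 2"
        using head[OF x, of k] reps_upto_val_ring[of "head k x" k] k(1,2) e
        by (intro taylor_approx[OF assms x _ k(3)]) auto
      ultimately have 1: "vabs (f x - sum w F0) \<le> e / 2" by simp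
      have "dist (sum w F) (f x) < e" if F: "finite F" "F0 \<subseteq> F" "F \<subseteq> reps \<pi> T \<times> {0..m}" for F
      proof -
        have "vabs (w i) \<le> e / 2" if i: "i \<in> F - F0" for i
        proof -
          obtain r j where rj: "i = (r, j)" "r \<in> reps \<pi> T - reps_upto \<pi> T k" "j \<le> m"
            using i F by (cases i) (auto simp: F0_def)
          have "vabs (wavelet \<pi> T m r j x) \<le> vabs (gam \<pi> T r) ^ m"
            using rj by (intro vabs_wavelet_le) auto
          also have "\<dots> \<le> 1" using rj vabs_gam_le_1 by (intro power_le_one) auto
          finally have "vabs (wcoeff m f r j) * vabs (wavelet \<pi> T m r j x) \<le> e / 2 * 1"
            using k(4) rj e by (intro mult_mono) auto
          then show ?thesis by (simp add: rj w_def vabs_times)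
        qed
        then have "vabs (sum w (F - F0)) \<le> e / 2" using e by (intro vabs_sum_le) auto
        moreover have "sum w F - f x = sum w (F - F0) - (f x - sum w F0)"
          using sum.subset_diff[OF F(2,1), of w] by simp
        ultimately have "vabs (sum w F - f x) \<le> e / 2" using 1 by (simp only: vabs_minus_le)
        then show ?thesis using e by (simp add: dist_eq_vabs)
      qed
      then show "\<forall>\<^sub>F F in finite_subsets_at_top (reps \<pi> T \<times> {0..m}). dist (sum w F) (f x) < e"
        unfolding eventually_finite_subsets_at_top using F0 by blast
    qed
    then show "((\<lambda>(r, j). wcoeff m f r j * wavelet \<pi> T m r j x) has_sum f x) (reps \<pi> T \<times> {0..m})"
      by (simp add: w_def)
  qed
qed

section \<open>Uniqueness of the expansion\<close>

lemma is_expansion_diff: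
  assumes "is_expansion \<pi> T m f b" "is_expansion \<pi> T m f b'"
  shows "is_expansion \<pi> T m (\<lambda>_. 0) (\<lambda>r j. b r j - b' r j)"
  unfolding is_expansion_def
proof (intro conjI)
  show "\<forall>r j. (r, j) \<notin> reps \<pi> T \<times> {0..m} \<longrightarrow> b r j - b' r j = 0"
    using assms unfolding is_expansion_def by simp
  have "((\<lambda>z. (case z of (r, j) \<Rightarrow> b r j) - (case z of (r, j) \<Rightarrow> b' r j)) \<longlongrightarrow> 0 - 0) cofinite"
    using assms unfolding is_expansion_def by (intro tendsto_diff) auto
  then show "((\<lambda>(r, j). b r j - b' r j) \<longlongrightarrow> 0) cofinite"
    by (simp add: case_prod_unfold)
  show "\<forall>x\<in>val_ring. ((\<lambda>(r, j). (b r j - b' r j) * wavelet \<pi> T m r j x) has_sum 0) (reps \<pi> T \<times> {0..m})"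
  proof
    fix x :: 'a assume "x \<in> val_ring"
    then have b: "((\<lambda>(r, j). b r j * wavelet \<pi> T m r j x) has_sum f x) (reps \<pi> T \<times> {0..m})"
      and b': "((\<lambda>(r, j). b' r j * wavelet \<pi> T m r j x) has_sum f x) (reps \<pi> T \<times> {0..m})"
      using assms unfolding is_expansion_def by blast+
    from has_sum_add[OF b has_sum_uminusI[OF b']]
    show "((\<lambda>(r, j). (b r j - b' r j) * wavelet \<pi> T m r j x) has_sum 0) (reps \<pi> T \<times> {0..m})"
      by (simp add: case_prod_unfold left_diff_distrib)
  qed
qed

text \<open>Induction on the length of \<open>r\<close>: at \<open>x = r + \<pi> ^ k\<close> the surviving terms other than those
  of \<open>r\<close> belong to indices of length more than \<open>k\<close>, and they are \<open>o (vabs \<pi> ^ (k * m))\<close>.\<close>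

lemma zero_expansion_eq_0:
  assumes "is_expansion \<pi> T m (\<lambda>_. 0) d" "r \<in> reps \<pi> T"
  shows "d r j = 0"
  using assms(2)
proof (induction "len \<pi> T r" arbitrary: r j rule: less_induct)
  case less
  note r = less.prems
  have out: "\<And>s j. (s, j) \<notin> reps \<pi> T \<times> {0..m} \<Longrightarrow> d s j = 0"
    and lim: "((\<lambda>(s, j). d s j) \<longlongrightarrow> 0) cofinite"
    and sums: "\<And>x. x \<in> val_ring \<Longrightarrow>
      ((\<lambda>(s, j). d s j * wavelet \<pi> T m s j x) has_sum 0) (reps \<pi> T \<times> {0..m})"
    using assms(1) unfolding is_expansion_def by auto
  \<comment> \<open>In the variable x - r, the part of the series at index \<open>r\<close> on its
    support; it is to vanish as a polynomial.\<close>
  define p where "p = (\<Sum>j=0..m. monom (d r j * gam \<pi> T r ^ (m - j)) j)"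
  have "p = 0"
  proof (rule poly_eq_0_if_small[OF _ pi_nonzero vabs_pi_less_1])
    show "degree p \<le> m"
      unfolding p_def by (intro degree_sum_le) (auto intro: order_trans[OF degree_monom_le])
    fix \<epsilon> :: real assume \<epsilon>: "0 < \<epsilon>"
    have "finite {z. \<not> dist (case z of (s, j) \<Rightarrow> d s j) 0 < \<epsilon>}"
      using lim \<epsilon> unfolding tendsto_iff eventually_cofinite by blast
    then have fin: "finite ((\<lambda>(s, j). len \<pi> T s) ` {z. \<not> dist (case z of (s, j) \<Rightarrow> d s j) 0 < \<epsilon>})"
      by (rule finite_imageI)
    \<comment> \<open>Only finitely many coefficients fail to be smaller than \<epsilon>, so their
      indices have bounded length.\<close>
    obtain K where K: "\<And>s j. \<not> dist (d s j) 0 < \<epsilon> \<Longrightarrow> len \<pi> T s \<le> K"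
    proof -
      obtain K where "\<forall>l\<in>(\<lambda>(s, j). len \<pi> T s) ` {z. \<not> dist (case z of (s, j) \<Rightarrow> d s j) 0 < \<epsilon>}. l \<le> K"
        using fin unfolding finite_nat_set_iff_bounded_le by blast
      then show thesis by (intro that[of K]) force
    qed
    show "\<forall>\<^sub>F k in sequentially. vabs (poly p (\<pi> ^ k)) \<le> \<epsilon> * vabs \<pi> ^ (k * m)"
      using eventually_ge_at_top[of "max K (len \<pi> T r)"]
    proof eventually_elim
      case (elim k)
      define x where "x = r + \<pi> ^ k"
      have x: "vabs x \<le> 1" unfolding x_def using reps_vabs_le_1[OF r] by (rule node_val_ring)
      have xr: "vabs (x - r) = vabs \<pi> ^ k" by (simp add: x_def vabs_power)
      have chir: "chi \<pi> T r x = 1"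
        using elim vabs_pi_power_mono[of "len \<pi> T r" k] by (simp add: chi_eq xr)
      define w where "w = (\<lambda>(s, j). d s j * wavelet \<pi> T m s j x)"
      \<comment> \<open>Isolates the terms at \<open>r\<close>: wr - w sums to the value of
        \<open>p\<close>, while its nonzero terms have indices other than \<open>r\<close>.\<close>
      define wr where "wr = (\<lambda>(s, j). if s = r then d s j * wavelet \<pi> T m s j x else 0)"
      have "sum wr ({r} \<times> {0..m}) = (\<Sum>s\<in>{r}. \<Sum>j=0..m. d s j * wavelet \<pi> T m s j x)"
        unfolding sum.cartesian_product by (rule sum.cong) (auto simp: wr_def)
      also have "\<dots> = poly p (\<pi> ^ k)"
        using chir by (simp add: p_def poly_sum poly_monom wavelet_def mult.assoc) (simp add: x_def)
      finally have sumr: "sum wr ({r} \<times> {0..m}) = poly p (\<pi> ^ k)" .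
      have "(wr has_sum poly p (\<pi> ^ k)) ({r} \<times> {0..m})"
        unfolding sumr[symmetric] by (rule has_sum_finite) simp
      then have wr: "(wr has_sum poly p (\<pi> ^ k)) (reps \<pi> T \<times> {0..m})"
        using r by (subst has_sum_cong_neutral[where T = "{r} \<times> {0..m}" and g = wr]) (auto simp: wr_def split: if_splits)
      have "(w has_sum 0) (reps \<pi> T \<times> {0..m})"
        unfolding w_def using x by (intro sums) (simp add: val_ring_iff)
      from has_sum_add[OF wr has_sum_uminusI[OF this]]
      have "((\<lambda>z. wr z - w z) has_sum poly p (\<pi> ^ k)) (reps \<pi> T \<times> {0..m})" by simp
      then show ?case
      proof (rule has_sum_vabs_le)
        fix z assume "z \<in> reps \<pi> T \<times> {0..m}"
        then obtain s i where z: "z = (s, i)" "s \<in> reps \<pi> T" "i \<le> m" by auto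
        show "vabs (wr z - w z) \<le> \<epsilon> * vabs \<pi> ^ (k * m)"
        proof (cases "s = r \<or> d s i = 0 \<or> chi \<pi> T s x = 0")
          case True
          then show ?thesis using \<epsilon> by (auto simp: wr_def w_def z wavelet_def)
        next
          case False
          then have near: "vabs (x - s) \<le> vabs \<pi> ^ len \<pi> T s" by (auto simp: chi_eq split: if_splits)
          \<comment> \<open>Otherwise \<open>s\<close> and \<open>r\<close> lie in one ball of
            radius \<open>vabs \<pi> ^ len \<pi> T s\<close>. The induction hypothesis excludes that
            \<open>s\<close> is shorter than \<open>r\<close>, so both belong to the same
            \<open>reps_upto\<close> and coincide.\<close>
          have "k < len \<pi> T s"
          proof (rule ccontr)
            assume "\<not> k < len \<pi> T s"
            then have "vabs (x - r) \<le> vabs \<pi> ^ len \<pi> T s" by (simp add: xr vabs_pi_power_mono)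
            then have "vabs (s - r) \<le> vabs \<pi> ^ len \<pi> T s"
              using near by (metis vabs_diff_trans_le vabs_minus_commute)
            moreover have "len \<pi> T r \<le> len \<pi> T s" using False less.hyps[of s i] z by fastforce
            ultimately have "s = r" using z r len_le_iff by (intro reps_upto_eqI[of s "len \<pi> T s" r]) auto
            then show False using False by simp
          qed
          then have "vabs (gam \<pi> T s) \<le> vabs \<pi> ^ k" by (rule vabs_gam_le_pi_power[OF z(2)])
          then have "vabs (gam \<pi> T s) ^ m \<le> vabs \<pi> ^ (k * m)"
            by (simp add: power_mult power_mono)
          then have "vabs (wavelet \<pi> T m s i x) \<le> vabs \<pi> ^ (k * m)"
            using vabs_wavelet_le[OF z(2,3), of x] by linarith
          moreover have "vabs (d s i) \<le> \<epsilon>"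
            using K[of s i] \<open>k < len \<pi> T s\<close> elim by (force simp: dist_eq_vabs)
          ultimately have "vabs (d s i * wavelet \<pi> T m s i x) \<le> \<epsilon> * vabs \<pi> ^ (k * m)"
            unfolding vabs_times using \<epsilon> by (intro mult_mono) auto
          then show ?thesis using False by (simp add: wr_def w_def z)
        qed
      qed (use \<epsilon> in simp)
    qed
  qed
  then have "poly.coeff p j = 0" by simp
  then show ?case
    using out[of r j] gam_nonzero[OF r] by (cases "j \<le> m") (auto simp: p_def coeff_sum)
qed

lemma is_expansion_unique:
  assumes "is_expansion \<pi> T m f b" "is_expansion \<pi> T m f b'"
  shows "b = b'"
proof (intro ext)
  fix r j
  show "b r j = b' r j"
  proof (cases "r \<in> reps \<pi> T")
    case True
    then show ?thesis using zero_expansion_eq_0[OF is_expansion_diff[OF assms]] by fastforce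
  next
    case False
    then show ?thesis using assms unfolding is_expansion_def by simp
  qed
qed

lemma coeff_eq_wcoeff: "uniform_swap m f \<Longrightarrow> coeff \<pi> T m f = wcoeff m f"
  unfolding coeff_def
  by (rule the_equality) (auto intro: is_expansion_wcoeff is_expansion_unique)

end

section \<open>Divided differences of an expansion\<close>

lemma divdiff_mult_const: "divdiff (\<lambda>x. c * f x) S = c * divdiff f S"
  by (simp add: divdiff_def sum_distrib_left)

text \<open>In the Leibniz rule a linear factor costs \<rho> either through its value at a node or
  through the loss of a node.\<close>

lemma divdiff_monomial_le:
  fixes c :: "'a::nonarch_field"
  assumes "finite S" "\<And>x. x \<in> S \<Longrightarrow> vabs (x - c) \<le> \<rho>" "0 \<le> \<rho>"
  shows "vabs (divdiff (\<lambda>x. (x - c) ^ j) S) * \<rho> ^ card S \<le> \<rho> ^ Suc j"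
  using assms
proof (induction j arbitrary: S)
  case 0
  then show ?case using divdiff_const[of S "1::'a"] by simp
next
  case (Suc j)
  show ?case
  proof (cases "S = {}")
    case False
    then obtain a where a: "a \<in> S" by blast
    have card: "card S = Suc (card (S - {a}))" using Suc.prems(1) a by (rule card.remove)
    let ?d = "\<lambda>S. divdiff (\<lambda>x. (x - c) ^ j) S"
    have "vabs (a - c) * (vabs (?d S) * \<rho> ^ card S) \<le> \<rho> * \<rho> ^ Suc j"
      using Suc a by (intro mult_mono) auto
    then have 1: "vabs ((a - c) * ?d S) * \<rho> ^ card S \<le> \<rho> ^ Suc (Suc j)"
      by (simp add: vabs_times mult.assoc)
    have "\<rho> * (vabs (?d (S - {a})) * \<rho> ^ card (S - {a})) \<le> \<rho> * \<rho> ^ Suc j"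
      using Suc.prems by (intro mult_left_mono Suc.IH) auto
    then have 2: "vabs (?d (S - {a})) * \<rho> ^ card S \<le> \<rho> ^ Suc (Suc j)"
      by (simp add: card mult.left_commute)
    have "vabs ((a - c) * ?d S + ?d (S - {a})) * \<rho> ^ card S
        \<le> max (vabs ((a - c) * ?d S)) (vabs (?d (S - {a}))) * \<rho> ^ card S"
      using Suc.prems(3) by (intro mult_right_mono vabs_plus_le_max) auto
    also have "\<dots> \<le> \<rho> ^ Suc (Suc j)" using 1 2 by (metis max_def)
    finally show ?thesis
      using divdiff_linear_mult[OF Suc.prems(1) a, of c "\<lambda>x. (x - c) ^ j"] by simp
  qed (use Suc.prems in simp)
qed

context digit_system
begin

text \<open>A point inside and a point outside the support of \<open>chi\<close> are at distance at least
  \<open>vabs (gam r)\<close>, so each use of the recursion on such a pair costs only one factor \<open>vabs (gam r)\<close>.\<close>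

lemma divdiff_local_monomial_le:
  assumes "r \<in> reps_plus \<pi> T" "finite S"
  shows "vabs (divdiff (\<lambda>x. (x - r) ^ j * chi \<pi> T r x) S) * vabs (gam \<pi> T r) ^ card S
    \<le> vabs (gam \<pi> T r) ^ Suc j"
  using assms(2)
proof (induction "card S" arbitrary: S)
  case 0
  then show ?case by simp
next
  case (Suc n)
  define g where "g = vabs (gam \<pi> T r)"
  define h where "h = (\<lambda>x. (x - r) ^ j * chi \<pi> T r x)"
  define D where "D = {x. vabs (x - r) \<le> vabs \<pi> ^ len \<pi> T r}"
  obtain k where k: "len \<pi> T r = Suc k" "g = vabs \<pi> ^ k"
    using assms(1) unfolding g_def by (rule reps_plus_cases)
  have g: "0 < g" by (simp add: k)
  have inD: "x \<in> D \<Longrightarrow> h x = (x - r) ^ j" and outD: "x \<notin> D \<Longrightarrow> h x = 0" for x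
    by (simp_all add: D_def h_def chi_eq)
  have Dg: "vabs (x - r) \<le> g" if "x \<in> D" for x
    using that vabs_pi_power_mono[of k "Suc k"] unfolding D_def mem_Collect_eq k by linarith
  consider "S \<subseteq> D" | "S \<inter> D = {}" | a b where "a \<in> S" "b \<in> S" "a \<in> D" "b \<notin> D" by blast
  then have "vabs (divdiff h S) * g ^ card S \<le> g ^ Suc j"
  proof cases
    case 1
    then have "divdiff h S = divdiff (\<lambda>x. (x - r) ^ j) S"
      by (intro divdiff_cong inD) auto
    then show ?thesis
      using divdiff_monomial_le[OF Suc.prems, of r g j] Dg 1 g by auto
  next
    case 2
    then have "divdiff h S = divdiff (\<lambda>_. 0) S"
      by (intro divdiff_cong outD) auto
    then show ?thesis using g by (simp add: divdiff_def)
  next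
    case 3
    define S' where "S' = S - {a, b}"
    have ab: "a \<noteq> b" using 3 by auto
    have S: "S = insert a (insert b S')" "a \<notin> S'" "b \<notin> S'" "finite S'"
      using 3 Suc.prems by (auto simp: S'_def)
    have card: "n = card (insert a S')" "n = card (insert b S')"
      using Suc.hyps(2) S ab by auto
    \<comment> \<open>By discreteness points outside the support are at distance at least |\<pi>|^k
      from \<open>r\<close>, while points of the support are strictly closer. Hence |a - b| = |b -
      r|.\<close>
    have "\<not> vabs (b - r) < vabs \<pi> ^ k"
      using vabs_less_pi_power[of "b - r" k] 3(4) by (auto simp: D_def k)
    moreover have "vabs (a - r) < vabs \<pi> ^ k"
      using 3(3) vabs_pi_power_strict_mono[of k "Suc k"] unfolding D_def mem_Collect_eq k by linarith
    ultimately have "vabs ((b - a) - (b - r)) < vabs (b - r)" by (simp add: vabs_minus_commute[of r a])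
    then have "vabs (b - a) = vabs (b - r)" by (rule vabs_eq_if_diff_less)
    with \<open>\<not> vabs (b - r) < vabs \<pi> ^ k\<close> have gab: "g \<le> vabs (a - b)"
      by (simp add: k vabs_minus_commute[of a b])
    have IH: "vabs (divdiff h S) * g ^ n \<le> g ^ Suc j" if "n = card S" "finite S" for S
      using Suc.hyps(1)[OF that] unfolding g_def h_def that(1) .
    have "vabs (divdiff h (insert a S') - divdiff h (insert b S')) * g ^ n
        \<le> max (vabs (divdiff h (insert a S'))) (vabs (divdiff h (insert b S'))) * g ^ n"
      using vabs_plus_le_max[of "divdiff h (insert a S')" "- divdiff h (insert b S')"] g
      by (intro mult_right_mono) auto
    also have "\<dots> \<le> g ^ Suc j"
      using IH[OF card(1)] IH[OF card(2)] S(4) by (simp add: max_def)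
    also have "divdiff h (insert a S') - divdiff h (insert b S') = (a - b) * divdiff h S"
      using divdiff_insert2[OF S(4,2,3) ab, of h] ab by (simp add: S(1))
    finally have "vabs (a - b) * (vabs (divdiff h S) * g ^ n) \<le> g ^ Suc j"
      by (simp add: vabs_times mult.assoc)
    moreover have "g * (vabs (divdiff h S) * g ^ n) \<le> vabs (a - b) * (vabs (divdiff h S) * g ^ n)"
      using gab g by (intro mult_right_mono) auto
    ultimately show ?thesis
      by (simp add: Suc.hyps(2)[symmetric] mult.left_commute)
  qed
  then show ?case by (simp add: g_def h_def)
qed

text \<open>With m + 2 nodes the exponents of |\<gamma>_r| add up to (m - j) + (j + 1) - (m + 2) =
  -1.\<close>

lemma divdiff_wavelet_le:
  assumes "r \<in> reps_plus \<pi> T" "j \<le> m" "finite S" "card S = Suc (Suc m)"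
  shows "vabs (divdiff (wavelet \<pi> T m r j) S) * vabs (gam \<pi> T r) \<le> 1"
proof -
  define g where "g = vabs (gam \<pi> T r)"
  define h where "h = (\<lambda>x. (x - r) ^ j * chi \<pi> T r x)"
  have g: "0 < g" using gam_nonzero[of r] assms(1) by (auto simp: g_def reps_plus_def)
  have "wavelet \<pi> T m r j = (\<lambda>x. gam \<pi> T r ^ (m - j) * h x)"
    by (auto simp: wavelet_def h_def mult.assoc)
  then have "vabs (divdiff (wavelet \<pi> T m r j) S) = g ^ (m - j) * vabs (divdiff h S)"
    by (simp add: divdiff_mult_const vabs_times vabs_power g_def)
  then have "(vabs (divdiff (wavelet \<pi> T m r j) S) * g) * g ^ Suc m = g ^ (m - j) * (vabs (divdiff h S) * g ^ card S)"
    by (simp add: assms(4))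
  also have "\<dots> \<le> g ^ (m - j) * g ^ Suc j"
    using divdiff_local_monomial_le[OF assms(1,3), of j] g
    by (intro mult_left_mono) (auto simp: g_def h_def)
  also have "\<dots> = 1 * g ^ Suc m"
    using assms(2) by (simp flip: power_add power_Suc)
  finally have "(vabs (divdiff (wavelet \<pi> T m r j) S) * g) * g ^ Suc m \<le> 1 * g ^ Suc m" .
  then show ?thesis using g unfolding g_def by (simp only: mult_le_cancel_right_pos zero_less_power)
qed

text \<open>On the valuation ring \<chi>_0 is 1, so the wavelet is a monomial of degree at most
  \<open>m\<close>, killed by divided differences of order m + 1.\<close>

lemma divdiff_wavelet_0:
  assumes "j \<le> m" "finite S" "card S = Suc (Suc m)" "S \<subseteq> val_ring"
  shows "divdiff (wavelet \<pi> T m 0 j) S = 0"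
proof -
  have "divdiff (wavelet \<pi> T m 0 j) S = divdiff (\<lambda>x. (x - 0) ^ j) S"
    using assms(4) by (intro divdiff_cong) (auto simp: wavelet_def chi_eq val_ring_iff)
  then show ?thesis using assms divdiff_monomial_eq_0[of S j 0] by simp
qed

text \<open>A divided difference is a finite linear combination of values, so it applies to the
  series term by term, and each term is at most \<open>A\<close>.\<close>

lemma divdiff_expansion_le:
  assumes "is_expansion \<pi> T m f b" "finite S" "card S = Suc (Suc m)" "S \<subseteq> val_ring"
    and "\<And>r j. r \<in> reps_plus \<pi> T \<Longrightarrow> j \<le> m \<Longrightarrow> vabs (b r j * inverse (gam \<pi> T r)) \<le> A"
  shows "vabs (divdiff f S) \<le> A"
proof -
  define Q where "Q a = (\<Prod>b\<in>S - {a}. a - b)" for a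
  have "((\<lambda>(r, j). b r j * wavelet \<pi> T m r j a) has_sum f a) (reps \<pi> T \<times> {0..m})" if "a \<in> S" for a
    using assms(1,4) that unfolding is_expansion_def by blast
  then have "((\<lambda>z. inverse (Q a) * (case z of (r, j) \<Rightarrow> b r j * wavelet \<pi> T m r j a)) has_sum inverse (Q a) * f a)
      (reps \<pi> T \<times> {0..m})" if "a \<in> S" for a
    using that by (intro has_sum_cmult_right)
  then have "((\<lambda>z. \<Sum>a\<in>S. inverse (Q a) * (case z of (r, j) \<Rightarrow> b r j * wavelet \<pi> T m r j a)) has_sum
      (\<Sum>a\<in>S. inverse (Q a) * f a)) (reps \<pi> T \<times> {0..m})"
    by (rule has_sum_finite_sum)
  moreover have "(\<Sum>a\<in>S. inverse (Q a) * f a) = divdiff f S"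
    by (simp add: divdiff_def Q_def divide_inverse mult.commute)
  moreover have "(\<Sum>a\<in>S. inverse (Q a) * (case z of (r, j) \<Rightarrow> b r j * wavelet \<pi> T m r j a)) =
      (case z of (r, j) \<Rightarrow> b r j * divdiff (wavelet \<pi> T m r j) S)" for z
    by (simp add: divdiff_def Q_def divide_inverse sum_distrib_left mult_ac split: prod.split)
  ultimately have sum: "((\<lambda>(r, j). b r j * divdiff (wavelet \<pi> T m r j) S) has_sum divdiff f S) (reps \<pi> T \<times> {0..m})"
    by simp
  \<comment> \<open>Any index in \<open>reps_plus\<close> yields A \<ge> 0, which bounds the
    vanishing terms at index 0.\<close>
  obtain r0 where r0: "r0 \<in> reps_plus \<pi> T" using reps_plus_nonempty by blast
  then have "0 \<le> A" using assms(5)[of r0 0] order_trans[OF vabs_nonneg] by blast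
  show ?thesis
  proof (rule has_sum_vabs_le[OF sum _ \<open>0 \<le> A\<close>])
    fix z assume "z \<in> reps \<pi> T \<times> {0..m}"
    then obtain r j where z: "z = (r, j)" "r \<in> reps \<pi> T" "j \<le> m" by auto
    have "vabs (b r j * divdiff (wavelet \<pi> T m r j) S) \<le> A"
      using z(2)
    proof (cases rule: reps_cases)
      case 1
      then show ?thesis using divdiff_wavelet_0[OF z(3) assms(2-4)] \<open>0 \<le> A\<close> by simp
    next
      case 2
      have nz: "gam \<pi> T r \<noteq> 0" by (rule gam_nonzero[OF z(2)])
      have "vabs (b r j * inverse (gam \<pi> T r)) * (vabs (divdiff (wavelet \<pi> T m r j) S) * vabs (gam \<pi> T r)) \<le> A * 1"
        using assms(5)[OF 2 z(3)] divdiff_wavelet_le[OF 2 z(3) assms(2,3)] \<open>0 \<le> A\<close>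
        by (intro mult_mono) auto
      moreover have "vabs (b r j * inverse (gam \<pi> T r)) * (vabs (divdiff (wavelet \<pi> T m r j) S) * vabs (gam \<pi> T r))
          = vabs (b r j * divdiff (wavelet \<pi> T m r j) S)"
        unfolding vabs_times vabs_inverse using nz by (simp add: field_simps)
      ultimately show ?thesis by simp
    qed
    then show "vabs (case z of (r, j) \<Rightarrow> b r j * divdiff (wavelet \<pi> T m r j) S) \<le> A" by (simp add: z)
  qed
qed

end

section \<open>Difference quotients and continuous extension\<close>

text \<open>The recursion drops the second coordinate in one term and the first in the other; the
  remaining ones form the shared node set of \<open>divdiff_insert2\<close>.\<close>

lemma diff_quot_eq_divdiff:
  fixes x :: "nat \<Rightarrow> 'a::local_field"
  shows "inj_on x {..k} \<Longrightarrow> diff_quot k f x = divdiff f (x ` {..k})"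
proof (induction k arbitrary: x)
  case 0
  have "{..0::nat} = {0}" by auto
  then show ?case by simp
next
  case (Suc k)
  define S where "S = x ` {2..Suc k}"
  let ?y = "\<lambda>i. if i = 0 then x 0 else x (Suc i)" and ?z = "\<lambda>i. x (Suc i)"
  have at: "{..Suc k} = {0, 1} \<union> {2..Suc k}" "{..k} = {0} \<union> {1..k}" by auto
  have shift: "Suc ` {1..k} = {2..Suc k}" by (simp add: image_Suc_atLeastAtMost numeral_2_eq_2)
  have z: "?z ` {1..k} = S" unfolding S_def shift[symmetric] image_image ..
  have y: "?y ` {1..k} = S"
    unfolding z[symmetric] by (intro image_cong) auto
  have eq: "?y ` {..k} = insert (x 0) S" "?z ` {..k} = insert (x 1) S" "x ` {..Suc k} = insert (x 0) (insert (x 1) S)"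
    unfolding at(2) image_Un y z by (simp_all add: at(1) S_def)
  have inj: "inj_on ?y {..k}" "inj_on ?z {..k}"
    using Suc.prems by (auto simp: inj_on_def)
  have ne: "x 0 \<notin> S" "x 1 \<notin> S" "x 0 \<noteq> x 1"
    using Suc.prems by (auto simp: S_def dest: inj_onD)
  have "diff_quot (Suc k) f x = (divdiff f (?y ` {..k}) - divdiff f (?z ` {..k})) / (x 0 - x 1)"
    using Suc.IH[OF inj(1)] Suc.IH[OF inj(2)] by simp
  also have "\<dots> = divdiff f (x ` {..Suc k})"
    unfolding eq using ne divdiff_insert2[of S "x 0" "x 1" f] by (simp add: S_def)
  finally show ?case .
qed

lemma distinct_tuples_iff:
  "x \<in> distinct_tuples (Suc k) \<longleftrightarrow>
    (\<forall>i\<le>k. x i \<in> val_ring) \<and> (\<forall>i>k. x i = undefined) \<and> inj_on x {..k}"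
  by (auto simp: distinct_tuples_def tuples_def PiE_def extensional_def Pi_iff less_Suc_eq_le lessThan_Suc_atMost)

lemma diff_quot_distinct_tuples:
  "x \<in> distinct_tuples (Suc k) \<Longrightarrow> diff_quot k f x = divdiff f (x ` {..k})"
  by (intro diff_quot_eq_divdiff) (simp add: distinct_tuples_iff)

text \<open>Every set of n + 1 points is the range of an injective tuple, and by symmetry the
  enumeration does not matter.\<close>

lemma Lipschitz_const_le_iff:
  fixes f :: "'a::local_field \<Rightarrow> 'a"
  shows "Lipschitz_const n f \<le> ereal A \<longleftrightarrow>
    (\<forall>S\<subseteq>val_ring. card S = Suc n \<longrightarrow> vabs (divdiff f S) \<le> A)"
proof
  assume L: "Lipschitz_const n f \<le> ereal A"
  show "\<forall>S\<subseteq>val_ring. card S = Suc n \<longrightarrow> vabs (divdiff f S) \<le> A"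
  proof (intro allI impI)
    fix S :: "'a set" assume S: "S \<subseteq> val_ring" "card S = Suc n"
    then have "finite S" by (metis card.infinite Zero_not_Suc)
    then obtain e where e: "bij_betw e {0..<card S} S" using ex_bij_betw_nat_finite by blast
    have at: "{0..<card S} = {..n}" using S by auto
    define x where "x i = (if i \<le> n then e i else undefined)" for i
    have inj: "inj_on x {..n}" and im: "x ` {..n} = S"
      using e unfolding at bij_betw_def by (auto simp: x_def inj_on_def)
    then have x: "x \<in> distinct_tuples (Suc n)"
      using S by (auto simp: distinct_tuples_iff x_def)
    then have "ereal (vabs (diff_quot n f x)) \<le> ereal A"
      using L unfolding Lipschitz_const_def SUP_le_iff by blast
    then show "vabs (divdiff f S) \<le> A" by (simp add: diff_quot_distinct_tuples[OF x] im)
  qed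
next
  assume A: "\<forall>S\<subseteq>val_ring. card S = Suc n \<longrightarrow> vabs (divdiff f S) \<le> A"
  show "Lipschitz_const n f \<le> ereal A"
    unfolding Lipschitz_const_def
  proof (rule SUP_least)
    fix x :: "nat \<Rightarrow> 'a" assume x: "x \<in> distinct_tuples (Suc n)"
    then have "x ` {..n} \<subseteq> val_ring" "card (x ` {..n}) = Suc n"
      by (auto simp: distinct_tuples_iff card_image)
    then show "ereal (vabs (diff_quot n f x)) \<le> ereal A"
      using A by (simp add: diff_quot_distinct_tuples[OF x])
  qed
qed

section \<open>The product metric on tuples\<close>

lemma dist_fun_le:
  fixes u v :: "nat \<Rightarrow> 'b::metric_space"
  assumes "\<And>i. dist (u i) (v i) \<le> d"
  shows "dist u v \<le> 2 * d"
proof -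
  \<comment> \<open>Coordinates are weighted by the powers of 1/2, whose sum is the factor
    2.\<close>
  have "(\<lambda>n. (1/2) ^ n * d) sums (2 * d)"
    using sums_mult2[OF geometric_sums[of "1/2::real"], of d] by simp
  moreover have "summable (\<lambda>n. (1/2) ^ n * min (dist (u (from_nat n)) (v (from_nat n))) 1)"
    by (rule summable_comparison_test_ev[OF _ summable_geometric[of "1/2::real"]])
      (auto intro!: always_eventually simp: mult_left_le)
  moreover have "(1/2) ^ n * min (dist (u (from_nat n)) (v (from_nat n))) 1 \<le> (1/2) ^ n * d" for n :: nat
    using assms[of "from_nat n"] by (intro mult_left_mono) auto
  ultimately show ?thesis
    unfolding dist_fun_def by (metis (no_types, lifting) suminf_le sums_summable sums_unique)
qed

lemma dist_fun_ge:
  fixes u v :: "nat \<Rightarrow> 'b::metric_space"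
  shows "(1/2) ^ to_nat i * min (dist (u i) (v i)) 1 \<le> dist u v"
proof -
  have "summable (\<lambda>n. (1/2) ^ n * min (dist (u (from_nat n)) (v (from_nat n))) 1)"
    by (rule summable_comparison_test_ev[OF _ summable_geometric[of "1/2::real"]])
      (auto intro!: always_eventually simp: mult_left_le)
  from sum_le_suminf[OF this, of "{to_nat i}"] show ?thesis
    unfolding dist_fun_def by simp
qed

text \<open>Among finitely many coordinates there is a smallest weight, \<open>(1/2) ^ M\<close>,
  which determines \<eta>.\<close>

lemma dist_fun_uniform_coordinates:
  assumes "0 < \<delta>"
  shows "\<exists>\<eta>>0. \<forall>u v :: nat \<Rightarrow> 'b::metric_space. dist u v < \<eta> \<longrightarrow> (\<forall>i\<le>k. dist (u i) (v i) < \<delta>)"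
proof -
  define M where "M = Max ((to_nat :: nat \<Rightarrow> nat) ` {..k})"
  have "dist (u i) (v i) < \<delta>"
    if d: "dist u v < (1/2) ^ M * min \<delta> 1" and i: "i \<le> k" for u v :: "nat \<Rightarrow> 'b" and i
  proof (rule ccontr)
    assume "\<not> dist (u i) (v i) < \<delta>"
    then have "(1/2) ^ M * min \<delta> 1 \<le> (1/2) ^ to_nat i * min (dist (u i) (v i)) (1::real)"
      using i assms by (intro mult_mono power_decreasing) (auto simp: M_def)
    also have "\<dots> \<le> dist u v" by (rule dist_fun_ge)
    finally show False using d by simp
  qed
  then show ?thesis using assms by (intro exI[of _ "(1/2) ^ M * min \<delta> 1"]) auto
qed

section \<open>Compactness, density of distinct tuples, and functions of class
  \<open>C_k\<close>\<close>

context digit_system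
begin

text \<open>A closed ball in a complete space, covered by finitely many small balls around the
  elements of \<open>reps_upto\<close>.\<close>

lemma compact_val_ring: "compact (val_ring :: 'a set)"
  unfolding compact_eq_totally_bounded
proof (intro conjI allI impI)
  have "(val_ring :: 'a set) = cball 0 1"
    by (auto simp: val_ring_iff dist_eq_vabs)
  then show "complete (val_ring :: 'a set)" unfolding complete_eq_closed by (metis closed_cball)
  fix \<epsilon> :: real assume "0 < \<epsilon>"
  then obtain k where k: "vabs \<pi> ^ k < \<epsilon>" by (rule vabs_pi_power_less)
  have "val_ring \<subseteq> (\<Union>x\<in>reps_upto \<pi> T k. ball x \<epsilon>)"
  proof
    fix x :: 'a assume "x \<in> val_ring"
    then obtain s where "s \<in> reps_upto \<pi> T k" "vabs (x - s) \<le> vabs \<pi> ^ k"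
      using reps_upto_approx[of x k] by (auto simp: val_ring_iff)
    then have "s \<in> reps_upto \<pi> T k" "x \<in> ball s \<epsilon>"
      using k by (simp_all add: dist_eq_vabs vabs_minus_commute[of s x])
    then show "x \<in> (\<Union>x\<in>reps_upto \<pi> T k. ball x \<epsilon>)" by blast
  qed
  then show "\<exists>k. finite k \<and> (val_ring :: 'a set) \<subseteq> (\<Union>x\<in>k. ball x \<epsilon>)"
    using finite_reps_upto by blast
qed

text \<open>Extensional tuples form a full product with the one-point factor
  \<open>{undefined}\<close> from index \<open>k\<close> on, so Tychonoff's theorem applies.\<close>

lemma compact_tuples: "compact (tuples k :: (nat \<Rightarrow> 'a) set)"
proof -
  have "(tuples k :: (nat \<Rightarrow> 'a) set) = PiE UNIV (\<lambda>i. if i < k then val_ring else {undefined})"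
    by (auto simp: tuples_def PiE_def extensional_def Pi_iff split: if_splits)
  moreover have "compactin (product_topology (\<lambda>i. euclidean) UNIV)
      (PiE UNIV (\<lambda>i. if i < k then val_ring else {undefined}) :: (nat \<Rightarrow> 'a) set)"
    unfolding compactin_PiE by (simp add: compact_val_ring)
  ultimately show ?thesis by (simp add: euclidean_product_topology)
qed

text \<open>Once |\<pi>|^t is below every nonzero absolute value on the finite set \<open>E\<close>,
  a collision forces a difference in \<open>E\<close> to vanish. Then two distinct powers of \<pi>
  would agree or one would be 0.\<close>

lemma perturb:
  fixes x :: "nat \<Rightarrow> 'a"
  assumes "finite D"
  shows "\<forall>\<^sub>F t in sequentially. inj_on (\<lambda>i. x i + \<pi> ^ (t + i)) {..k} \<and> (\<lambda>i. x i + \<pi> ^ (t + i)) ` {..k} \<inter> D = {}"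
proof -
  define E where "E = (\<lambda>(i, d). x i - d) ` ({..k} \<times> (x ` {..k} \<union> D))"
  have "finite E" using assms by (simp add: E_def)
  moreover have "\<forall>e\<in>E. \<forall>\<^sub>F t in sequentially. (e = 0 \<or> vabs \<pi> ^ t < vabs e)"
  proof
    fix e show "\<forall>\<^sub>F t in sequentially. (e = 0 \<or> vabs \<pi> ^ t < vabs e)"
      using eventually_pi_power_less[of "vabs e"] by (cases "e = 0") auto
  qed
  ultimately have "\<forall>\<^sub>F t in sequentially. \<forall>e\<in>E. (e = 0 \<or> vabs \<pi> ^ t < vabs e)"
    by (rule eventually_ball_finite)
  then show ?thesis
  proof eventually_elim
    case (elim t)
    have small: "e = 0" if "e \<in> E" "vabs e \<le> vabs \<pi> ^ t" for e
      using elim that by force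
    have "i = j" if ij: "i \<le> k" "j \<le> k" "x i + \<pi> ^ (t + i) = x j + \<pi> ^ (t + j)" for i j
    proof -
      have e: "x i - x j = \<pi> ^ (t + j) - \<pi> ^ (t + i)" using ij(3) by (simp add: algebra_simps)
      have "vabs (x i - x j) \<le> vabs \<pi> ^ t"
        using vabs_pi_power_diff[of "t + j" "t + i"] vabs_pi_power_mono[of t "min (t + j) (t + i)"]
        unfolding e by linarith
      moreover have "x i - x j \<in> E" using ij by (auto simp: E_def intro!: image_eqI[of _ _ "(i, x j)"])
      ultimately have "x i - x j = 0" using small by blast
      then show ?thesis using e by simp
    qed
    moreover have "x i + \<pi> ^ (t + i) \<noteq> d" if id: "i \<le> k" "d \<in> D" for i d
    proof
      assume "x i + \<pi> ^ (t + i) = d"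
      then have e: "x i - d = - (\<pi> ^ (t + i))" by (simp add: algebra_simps)
      have "vabs (x i - d) \<le> vabs \<pi> ^ t"
        using vabs_pi_power_mono[of t "t + i"] unfolding e by (simp add: vabs_power)
      moreover have "x i - d \<in> E" using id by (auto simp: E_def intro!: image_eqI[of _ _ "(i, d)"])
      ultimately have "x i - d = 0" using small by blast
      then show False using e by simp
    qed
    ultimately show ?case by (auto simp: inj_on_def)
  qed
qed

lemma tuples_subset_closure: "(tuples (Suc k) :: (nat \<Rightarrow> 'a) set) \<subseteq> closure (distinct_tuples (Suc k))"
proof
  fix x :: "nat \<Rightarrow> 'a" assume x: "x \<in> tuples (Suc k)"
  show "x \<in> closure (distinct_tuples (Suc k))"
    unfolding closure_approachable
  proof (intro allI impI)
    fix \<epsilon> :: real assume \<epsilon>: "0 < \<epsilon>"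
    have "\<forall>\<^sub>F t in sequentially. vabs \<pi> ^ t < \<epsilon> / 2 \<and> inj_on (\<lambda>i. x i + \<pi> ^ (t + i)) {..k}"
      using eventually_pi_power_less[of "\<epsilon> / 2"] perturb[of "{}" x k] \<epsilon>
      by (auto intro: eventually_conj elim: eventually_mono)
    then obtain t where t: "vabs \<pi> ^ t < \<epsilon> / 2" "inj_on (\<lambda>i. x i + \<pi> ^ (t + i)) {..k}"
      unfolding eventually_sequentially by blast
    define y where "y i = (if i \<le> k then x i + \<pi> ^ (t + i) else undefined)" for i
    have xi: "x i \<in> val_ring" if "i \<le> k" for i
      using x that by (auto simp: tuples_def PiE_iff)
    have xu: "x i = undefined" if "i > k" for i
      using x that by (auto simp: tuples_def PiE_def extensional_def)
    have "y \<in> distinct_tuples (Suc k)"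
      using t(2) xi by (auto simp: distinct_tuples_iff y_def inj_on_def val_ring_iff node_val_ring)
    moreover have "dist (y i) (x i) \<le> vabs \<pi> ^ t" for i
      using xu[of i] vabs_pi_power_mono[of t "t + i"] by (simp add: y_def dist_eq_vabs vabs_power)
    then have "dist y x < \<epsilon>" using dist_fun_le[of y x "vabs \<pi> ^ t"] t(1) by simp
    ultimately show "\<exists>y\<in>distinct_tuples (Suc k). dist y x < \<epsilon>" by blast
  qed
qed

text \<open>The extension is uniformly continuous on the compact set of tuples, and exchanging a
  node moves a single coordinate.\<close>

lemma C_k_imp_uniform_swap:
  fixes f :: "'a \<Rightarrow> 'a"
  assumes "f \<in> C_k m"
  shows "uniform_swap m f"
  unfolding uniform_swap_def
proof (intro allI impI)
  fix \<epsilon> :: real assume \<epsilon>: "0 < \<epsilon>"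
  obtain g :: "(nat \<Rightarrow> 'a) \<Rightarrow> 'a" where g: "continuous_on (tuples (Suc m)) g"
    "\<And>x. x \<in> distinct_tuples (Suc m) \<Longrightarrow> g x = diff_quot m f x"
    using assms unfolding C_k_def by blast
  have "uniformly_continuous_on (tuples (Suc m)) g"
    by (rule compact_uniformly_continuous[OF g(1) compact_tuples])
  then obtain d where d: "d > 0"
    "\<And>u v. u \<in> tuples (Suc m) \<Longrightarrow> v \<in> tuples (Suc m) \<Longrightarrow> dist v u < d \<Longrightarrow> dist (g v) (g u) < \<epsilon>"
    unfolding uniformly_continuous_on_def using \<epsilon> by metis
  \<comment> \<open>Coordinates within d / 4 give distance at most d / 2 in the product
    metric.\<close>
  have "swap_le m f (d / 4) \<epsilon>"
    unfolding swap_le_def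
  proof (intro allI impI)
    fix S :: "'a set" and a b
    assume *: "finite S \<and> card S = m \<and> insert a (insert b S) \<subseteq> val_ring \<and> a \<notin> S \<and> b \<notin> S \<and> a \<noteq> b \<and> vabs (a - b) \<le> d / 4"
    then obtain e where e: "bij_betw e {0..<m} S" using ex_bij_betw_nat_finite by blast
    define u where "u c i = (if i < m then e i else if i = m then c else undefined)" for c i
    have inj: "inj_on e {0..<m}" and im: "e ` {0..<m} = S" using e by (auto simp: bij_betw_def)
    have at: "{..m} = insert m {0..<m}" by auto
    have uS: "u c ` {0..<m} = S" for c unfolding im[symmetric] by (intro image_cong) (auto simp: u_def)
    have um: "u c m = c" for c by (simp add: u_def)
    have imu: "u c ` {..m} = insert c S" for c by (simp add: at uS um)
    have u: "u c \<in> distinct_tuples (Suc m)" if "c \<notin> S" "c \<in> val_ring" for c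
    proof -
      have "inj_on (u c) {0..<m}" using inj by (auto simp: inj_on_def u_def)
      then have "inj_on (u c) {..m}" unfolding at using that uS[of c] um[of c] by auto
      moreover have "u c i \<in> val_ring" if "i \<le> m" for i
      proof -
        have "u c i \<in> insert c S" unfolding imu[symmetric] using that by simp
        then show ?thesis using * \<open>c \<in> val_ring\<close> by auto
      qed
      ultimately show ?thesis by (auto simp: distinct_tuples_iff u_def)
    qed
    have "dist (u a i) (u b i) \<le> d / 4" for i
      using * d(1) by (auto simp: u_def dist_eq_vabs)
    then have "dist (u a) (u b) \<le> 2 * (d / 4)" by (rule dist_fun_le)
    then have "dist (u a) (u b) < d" using d(1) by simp
    then have "dist (g (u a)) (g (u b)) < \<epsilon>"
      using d(2)[of "u b" "u a"] u[of a] u[of b] * by (auto simp: distinct_tuples_def)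
    then show "vabs (divdiff f (insert a S) - divdiff f (insert b S)) \<le> \<epsilon>"
      using g(2) u[of a] u[of b] * by (simp add: dist_eq_vabs diff_quot_distinct_tuples imu)
  qed
  then show "\<exists>\<delta>>0. swap_le m f \<delta> \<epsilon>" using d(1) by (intro exI[of _ "d / 4"]) auto
qed

text \<open>Two tuples may have entries in common, so that exchanging their entries one by one would
  create repetitions; a third tuple close to the first one and disjoint from both avoids this.\<close>

lemma uniform_swap_imp_C_k:
  fixes f :: "'a \<Rightarrow> 'a"
  assumes "uniform_swap m f"
  shows "f \<in> C_k m"
proof -
  have "uniformly_continuous_on (distinct_tuples (Suc m)) (diff_quot m f)"
    unfolding uniformly_continuous_on_def
  proof (intro allI impI)
    fix e :: real assume e: "0 < e"
    then obtain \<delta> where \<delta>: "\<delta> > 0" "swap_le m f \<delta> (e / 2)"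
      using assms unfolding uniform_swap_def by (meson half_gt_zero)
    obtain \<eta> where \<eta>: "\<eta> > 0" "\<And>u v :: nat \<Rightarrow> 'a. dist u v < \<eta> \<Longrightarrow> \<forall>i\<le>m. dist (u i) (v i) < \<delta>"
      using dist_fun_uniform_coordinates[OF \<delta>(1)] by metis
    have "dist (diff_quot m f v) (diff_quot m f u) < e"
      if uv: "u \<in> distinct_tuples (Suc m)" "v \<in> distinct_tuples (Suc m)" "dist v u < \<eta>" for u v
    proof -
      have "finite (u ` {..m} \<union> v ` {..m})" by simp
      from eventually_conj[OF eventually_pi_power_less[OF \<delta>(1)] perturb[OF this, of u m]]
      obtain t where t: "vabs \<pi> ^ t < \<delta>" "inj_on (\<lambda>i. u i + \<pi> ^ (t + i)) {..m}"
        "(\<lambda>i. u i + \<pi> ^ (t + i)) ` {..m} \<inter> (u ` {..m} \<union> v ` {..m}) = {}"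
        unfolding eventually_sequentially by blast
      define w where "w i = u i + \<pi> ^ (t + i)" for i
      have w: "inj_on w {..m}" "w ` {..m} \<inter> u ` {..m} = {}" "w ` {..m} \<inter> v ` {..m} = {}"
        using t(2,3) unfolding w_def by blast+
      have R: "u ` {..m} \<subseteq> val_ring" "v ` {..m} \<subseteq> val_ring" "inj_on u {..m}" "inj_on v {..m}"
        using uv by (auto simp: distinct_tuples_iff)
      have wR: "w ` {..m} \<subseteq> val_ring"
        using R(1) by (auto simp: w_def val_ring_iff node_val_ring image_subset_iff)
      have wu: "vabs (w i - u i) \<le> \<delta>" for i
        using t(1) vabs_pi_power_mono[of t "t + i"] by (simp add: w_def vabs_power)
      have "vabs (u i - v i) \<le> \<delta>" if "i \<le> m" for i
        using \<eta>(2)[OF uv(3)] that by (metis dist_commute dist_eq_vabs less_imp_le)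
      then have wv: "vabs (w i - v i) \<le> \<delta>" if "i \<le> m" for i
        using vabs_diff_trans_le[OF wu] that by blast
      have "vabs (divdiff f (w ` {..m}) - divdiff f (u ` {..m})) \<le> e / 2"
        "vabs (divdiff f (w ` {..m}) - divdiff f (v ` {..m})) \<le> e / 2"
        using divdiff_chain_le[OF \<delta>(2) _ w(1) R(3) w(2) wR R(1) wu]
          divdiff_chain_le[OF \<delta>(2) _ w(1) R(4) w(3) wR R(2) wv] e by auto
      then have "vabs (divdiff f (v ` {..m}) - divdiff f (u ` {..m})) \<le> e / 2"
        by (metis vabs_diff_trans_le vabs_minus_commute)
      then show ?thesis using e uv by (simp add: dist_eq_vabs diff_quot_distinct_tuples)
    qed
    then show "\<exists>d>0. \<forall>x\<in>distinct_tuples (Suc m). \<forall>x'\<in>distinct_tuples (Suc m).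
        dist x' x < d \<longrightarrow> dist (diff_quot m f x') (diff_quot m f x) < e"
      using \<eta>(1) by blast
  qed
  \<comment> \<open>Completeness of the field extends the difference quotient to the closure, which
    contains all tuples.\<close>
  then obtain g where g: "uniformly_continuous_on (closure (distinct_tuples (Suc m))) g"
    "\<And>x. x \<in> distinct_tuples (Suc m) \<Longrightarrow> diff_quot m f x = g x"
    by (rule uniformly_continuous_on_extension_on_closure) blast
  have "continuous_on (tuples (Suc m)) g"
    by (rule continuous_on_subset[OF uniformly_continuous_imp_continuous[OF g(1)] tuples_subset_closure])
  then show ?thesis using g(2) unfolding C_k_def by force
qed

section \<open>Lipschitz constants and suprema of coefficients\<close>

lemma Lipschitz_swap_le:
  fixes f :: "'a \<Rightarrow> 'a"
  assumes "Lipschitz_const (Suc m) f \<le> ereal A"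
  shows "swap_le m f \<delta> (A * \<delta>)"
  unfolding swap_le_def
proof (intro allI impI)
  fix S :: "'a set" and a b
  assume *: "finite S \<and> card S = m \<and> insert a (insert b S) \<subseteq> val_ring \<and> a \<notin> S \<and> b \<notin> S \<and> a \<noteq> b \<and> vabs (a - b) \<le> \<delta>"
  then have "vabs (divdiff f (insert a (insert b S))) \<le> A"
    using assms unfolding Lipschitz_const_le_iff by simp
  then have "vabs (divdiff f (insert a (insert b S))) * vabs (a - b) \<le> A * \<delta>"
    using * by (intro mult_mono) (auto intro: order_trans[OF vabs_nonneg])
  then show "vabs (divdiff f (insert a S) - divdiff f (insert b S)) \<le> A * \<delta>"
    using * divdiff_insert2[of S a b f] by (simp add: vabs_divide)
qed

text \<open>The valuation ring contains n + 1 distinct points, so the supremum runs over a nonempty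
  set.\<close>

lemma Lipschitz_bound_nonneg:
  fixes f :: "'a \<Rightarrow> 'a"
  assumes "Lipschitz_const n f \<le> ereal A"
  shows "0 \<le> A"
proof -
  have "nodes n 0 0 \<subseteq> val_ring" by (auto simp: nodes_def val_ring_iff vabs_power vabs_pi_power_le_1)
  then have "vabs (divdiff f (nodes n 0 0)) \<le> A"
    using assms card_nodes[of n 0 0] unfolding Lipschitz_const_le_iff by blast
  then show ?thesis using order_trans[OF vabs_nonneg] by blast
qed

lemma Lipschitz_imp_uniform_swap:
  fixes f :: "'a \<Rightarrow> 'a"
  assumes "Lipschitz_const (Suc m) f \<le> ereal A"
  shows "uniform_swap m f"
  unfolding uniform_swap_def
proof (intro allI impI)
  fix \<epsilon> :: real assume "0 < \<epsilon>"
  have A: "0 \<le> A" by (rule Lipschitz_bound_nonneg[OF assms])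
  \<comment> \<open>The constant A + 1 is positive, so that \<epsilon> / (A + 1) is a valid radius
    even for A = 0.\<close>
  have "Lipschitz_const (Suc m) f \<le> ereal (A + 1)"
    using assms by (rule order_trans) simp
  from Lipschitz_swap_le[OF this, of "\<epsilon> / (A + 1)"] have "swap_le m f (\<epsilon> / (A + 1)) \<epsilon>"
    using A by simp
  moreover have "0 < \<epsilon> / (A + 1)" using A \<open>0 < \<epsilon>\<close> by simp
  ultimately show "\<exists>\<delta>>0. swap_le m f \<delta> \<epsilon>" by blast
qed

lemma coeff_sup_le_iff:
  "coeff_sup \<pi> T (Suc m) f \<le> ereal A \<longleftrightarrow>
    (\<forall>r\<in>reps_plus \<pi> T. \<forall>j\<le>m. vabs (coeff \<pi> T m f r j * inverse (gam \<pi> T r)) \<le> A)"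
  by (auto simp: coeff_sup_def SUP_le_iff)

text \<open>Real upper bounds are compared, so infinite values are included. The expansion turns a
  bound on coefficients into one on divided differences; conversely a Lipschitz bound
  \<open>A\<close> allows \<epsilon> = A |\<gamma>_r| in \<open>wcoeff_le\<close>.\<close>

lemma Lipschitz_const_eq_coeff_sup:
  assumes "uniform_swap m f"
  shows "Lipschitz_const (Suc m) f = coeff_sup \<pi> T (Suc m) f"
proof (rule antisym)
  show "Lipschitz_const (Suc m) f \<le> coeff_sup \<pi> T (Suc m) f"
  proof (rule ereal_le_real)
    fix A assume "coeff_sup \<pi> T (Suc m) f \<le> ereal A"
    then have A: "vabs (wcoeff m f r j * inverse (gam \<pi> T r)) \<le> A" if "r \<in> reps_plus \<pi> T" "j \<le> m" for r j
      using that unfolding coeff_sup_le_iff coeff_eq_wcoeff[OF assms] by blast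
    show "Lipschitz_const (Suc m) f \<le> ereal A"
      unfolding Lipschitz_const_le_iff
    proof (intro allI impI)
      fix S :: "'a set" assume S: "S \<subseteq> val_ring" "card S = Suc (Suc m)"
      then have "finite S" by (metis card.infinite Zero_not_Suc)
      then show "vabs (divdiff f S) \<le> A"
        using S A by (intro divdiff_expansion_le[OF is_expansion_wcoeff[OF assms]])
    qed
  qed
  show "coeff_sup \<pi> T (Suc m) f \<le> Lipschitz_const (Suc m) f"
  proof (rule ereal_le_real)
    fix A assume L: "Lipschitz_const (Suc m) f \<le> ereal A"
    show "coeff_sup \<pi> T (Suc m) f \<le> ereal A"
      unfolding coeff_sup_le_iff coeff_eq_wcoeff[OF assms]
    proof (intro ballI allI impI)
      fix r j assume r: "r \<in> reps_plus \<pi> T"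
      have "gam \<pi> T r \<noteq> 0" using r gam_nonzero by (simp add: reps_plus_def)
      moreover have "vabs (wcoeff m f r j) \<le> A * vabs (gam \<pi> T r)"
        using Lipschitz_bound_nonneg[OF L] by (intro wcoeff_le[OF assms r Lipschitz_swap_le[OF L]]) simp
      ultimately show "vabs (wcoeff m f r j * inverse (gam \<pi> T r)) \<le> A"
        by (simp add: vabs_divide pos_divide_le_eq flip: divide_inverse)
    qed
  qed
qed

end

theorem theorem1p11:
  fixes \<pi> :: "'a::local_field" and T :: "'a set" and n :: nat and f :: "'a \<Rightarrow> 'a"
  assumes "uniformizer \<pi>" and "residue_reps T"
    and "n \<ge> 1" and "CHAR('a) > 0 \<longrightarrow> n \<le> CHAR('a)"
    and "continuous_on val_ring f"
  shows "(nth_Lipschitz n f \<longleftrightarrow> f \<in> C_k (n - 1) \<and> coeff_sup \<pi> T n f < \<infinity>) \<and>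
         (nth_Lipschitz n f \<longrightarrow> Lipschitz_const n f = coeff_sup \<pi> T n f)"
proof -
  interpret digit_system \<pi> T using assms(1,2) by unfold_locales
  obtain m where n: "n = Suc m" using assms(3) by (cases n) auto
  have swap: "uniform_swap m f" if "nth_Lipschitz n f"
  proof -
    have "Lipschitz_const n f < \<infinity>" using that by (simp add: nth_Lipschitz_def)
    then have "\<exists>A. Lipschitz_const n f \<le> ereal A"
      by (cases "Lipschitz_const n f") auto
    then obtain A where "Lipschitz_const n f \<le> ereal A" ..
    then show ?thesis unfolding n by (rule Lipschitz_imp_uniform_swap)
  qed
  have eq: "Lipschitz_const n f = coeff_sup \<pi> T n f" if "uniform_swap m f"
    unfolding n by (rule Lipschitz_const_eq_coeff_sup[OF that])
  show ?thesis
  proof (intro conjI iffI impI)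
    assume L: "nth_Lipschitz n f"
    show "f \<in> C_k (n - 1)" using uniform_swap_imp_C_k[OF swap[OF L]] by (simp add: n)
    show "Lipschitz_const n f = coeff_sup \<pi> T n f" by (rule eq[OF swap[OF L]])
    then show "coeff_sup \<pi> T n f < \<infinity>" using L by (simp add: nth_Lipschitz_def)
  next
    assume C: "f \<in> C_k (n - 1) \<and> coeff_sup \<pi> T n f < \<infinity>"
    \<comment> \<open>With \<open>f\<close> of class \<open>C_k m\<close>, equality of the constants
      transfers finiteness to the Lipschitz constant.\<close>
    then have "uniform_swap m f" using C_k_imp_uniform_swap by (simp add: n)
    then show "nth_Lipschitz n f" using C assms(5) eq by (simp add: nth_Lipschitz_def)
  qed
qed

end
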